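(* Let $G$ be a connected graph of order $n$, and let $m(-1)$ denote the multiplicity of $-1$ as an eigenvalue of the eccentricity matrix $\mathcal{A}(G)$. Let $\mathcal{G}_1=\{K_{n-4}\vee 4K_1,\ K_{n-4}\vee(2K_1\cup K_2),\ K_{n-4}\vee(P_3\cup K_1),\ K_{n-4}\vee 2K_2,\ K_{n-4}\vee P_4,\ K_{n-4}\vee(K_3\cup K_1),\ K_{n-4}\vee C_4\}$. Then: (i) $m(-1)=n-1$ if and only if $G\cong K_n$; (ii) $m(-1)\neq n-2$; (iii) for $n\geq 4$, $m(-1)=n-3$ if and only if $G\in\{K_{n-2}\vee 2K_1,\ P_4\}$; (iv) for $n\geq 9$, $m(-1)=n-4$ if and only if $G\in\{K_{n-3}\vee(K_2\cup K_1),\ K_{n-3}\vee 3K_1\}$; (v) for $n\geq 16$, $m(-1)=n-5$ if and only if $G\in\mathcal{G}_1\cup\{K_{n-5}\vee C_5,\ K_{n-5}\vee(K_1\cup P_4),\ K_{n-5}\vee H_1\}$, where $H_1$ is the bull graph.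
   Context: All graphs are simple. For a connected graph $G$, $d(u,v)$ is the distance between $u,v$ and the eccentricity of $v$ is $\varepsilon(v)=\max_{u\in V(G)} d(u,v)$. The eccentricity matrix $\mathcal{A}(G)$ is the matrix indexed by $V(G)$ whose $(u,v)$-entry is $d(u,v)$ if $d(u,v)=\min\{\varepsilon(u),\varepsilon(v)\}$ and $0$ otherwise. $K_n,P_n,C_n$ denote the complete graph, path and cycle on $n$ vertices; $kK_1$ (resp. $2K_2$) is the disjoint union of $k$ copies of $K_1$ (resp. two copies of $K_2$); $G\cup H$ is disjoint union; $G\vee H$ is the join (disjoint union plus all edges between $G$ and $H$). The bull graph $H_1$ has vertices $a,b,c,x,y$ and edges $ab,bc,ca,xa,yb$ (a triangle with pendant vertices attached to two distinct triangle vertices). *)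

theory Defs
  imports
    "Graph_Theory.Pair_Digraph"
    "Graph_Theory.Digraph_Component"
    "Graph_Theory.Digraph_Isomorphism"
    "Jordan_Normal_Form.Char_Poly"
begin

text \<open>Simple graphs are the finite, symmetric, loop-free digraphs without parallel arcs of the
  Graph-Theory library: an edge $uv$ is the pair of arcs $(u,v)$, $(v,u)$.\<close>

text \<open>Meaningful when \<open>v\<close> is reachable from \<open>u\<close>; a shortest walk is a path.\<close>

definition gdist :: "'a pair_pre_digraph \<Rightarrow> 'a \<Rightarrow> 'a \<Rightarrow> nat" where
  "gdist G u v = (LEAST k. \<exists>p. pre_digraph.awalk (with_proj G) u p v \<and> length p = k)"

definition eccentricity :: "'a pair_pre_digraph \<Rightarrow> 'a \<Rightarrow> nat" where
  "eccentricity G v = Max ((\<lambda>u. gdist G u v) ` pverts G)"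

definition ecc_entry :: "'a pair_pre_digraph \<Rightarrow> 'a \<Rightarrow> 'a \<Rightarrow> real" where
  "ecc_entry G u v =
     (if gdist G u v = min (eccentricity G u) (eccentricity G v) then real (gdist G u v) else 0)"

text \<open>Matrices are indexed by natural numbers, so the eccentricity matrix is taken with respect to
  a list \<open>vs\<close> enumerating the vertices without repetition.\<close>

definition ecc_mat :: "'a pair_pre_digraph \<Rightarrow> 'a list \<Rightarrow> real mat" where
  "ecc_mat G vs = mat (length vs) (length vs) (\<lambda>(i, j). ecc_entry G (vs ! i) (vs ! j))"

definition eigenvalue_multiplicity :: "real mat \<Rightarrow> real \<Rightarrow> nat" where
  "eigenvalue_multiplicity A a = Polynomial.order a (char_poly A)"

definition isomorphic :: "'a pair_pre_digraph \<Rightarrow> 'b pair_pre_digraph \<Rightarrow> bool" where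
  "isomorphic G H \<longleftrightarrow> digraph_iso (with_proj G) (with_proj H)"

definition complete_graph :: "nat \<Rightarrow> nat pair_pre_digraph" where
  "complete_graph k = \<lparr> pverts = {..<k}, parcs = {(u, v). u < k \<and> v < k \<and> u \<noteq> v} \<rparr>"

definition path_graph :: "nat \<Rightarrow> nat pair_pre_digraph" where
  "path_graph k = \<lparr> pverts = {..<k}, parcs = {(u, v). u < k \<and> v < k \<and> (v = u + 1 \<or> u = v + 1)} \<rparr>"

text \<open>A cycle only for \<open>k \<ge> 3\<close>.\<close>

definition cycle_graph :: "nat \<Rightarrow> nat pair_pre_digraph" where
  "cycle_graph k = \<lparr> pverts = {..<k},
     parcs = {(u, v). u < k \<and> v < k \<and> (v = (u + 1) mod k \<or> u = (v + 1) mod k)} \<rparr>"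

text \<open>The vertices $a,b,c,x,y$ are numbered $0,\dots,4$.\<close>

definition bull_graph :: "nat pair_pre_digraph" where
  "bull_graph = (let E = {(0, 1), (1, 2), (2, 0), (3, 0), (4, 1)}
     in \<lparr> pverts = {..<5}, parcs = E \<union> E\<inverse> \<rparr>)"

text \<open>To keep all vertices natural numbers, the left and right operands of a disjoint union or a
  join are placed on the even and the odd numbers.\<close>

definition disj_union ::
    "nat pair_pre_digraph \<Rightarrow> nat pair_pre_digraph \<Rightarrow> nat pair_pre_digraph" (infixl \<open>\<oplus>\<^sub>g\<close> 65) where
  "G \<oplus>\<^sub>g H = (let l = (\<lambda>i. 2 * i); r = (\<lambda>i. 2 * i + 1)
     in \<lparr> pverts = l ` pverts G \<union> r ` pverts H,
          parcs = map_prod l l ` parcs G \<union> map_prod r r ` parcs H \<rparr>)"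

definition join ::
    "nat pair_pre_digraph \<Rightarrow> nat pair_pre_digraph \<Rightarrow> nat pair_pre_digraph" (infixl \<open>\<or>\<^sub>g\<close> 60) where
  "G \<or>\<^sub>g H = (let L = (\<lambda>i. 2 * i) ` pverts G; R = (\<lambda>i. 2 * i + 1) ` pverts H
     in \<lparr> pverts = pverts (G \<oplus>\<^sub>g H), parcs = parcs (G \<oplus>\<^sub>g H) \<union> L \<times> R \<union> R \<times> L \<rparr>)"

primrec copies :: "nat \<Rightarrow> nat pair_pre_digraph \<Rightarrow> nat pair_pre_digraph" where
  "copies 0 G = \<lparr> pverts = {}, parcs = {} \<rparr>"
| "copies (Suc k) G = G \<oplus>\<^sub>g copies k G"

definition G1_family :: "nat \<Rightarrow> nat pair_pre_digraph set" where
  "G1_family n = (let K = complete_graph; P = path_graph; C = cycle_graph in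
     { K (n - 4) \<or>\<^sub>g copies 4 (K 1),
       K (n - 4) \<or>\<^sub>g (copies 2 (K 1) \<oplus>\<^sub>g K 2),
       K (n - 4) \<or>\<^sub>g (P 3 \<oplus>\<^sub>g K 1),
       K (n - 4) \<or>\<^sub>g copies 2 (K 2),
       K (n - 4) \<or>\<^sub>g P 4,
       K (n - 4) \<or>\<^sub>g (K 3 \<oplus>\<^sub>g K 1),
       K (n - 4) \<or>\<^sub>g C 4 })"

end

theory Submission
  imports Defs "HOL-Number_Theory.Cong"
begin

text \<open>Write \<open>M = \<A>(G) + I\<close> and \<open>r = n - m(-1)\<close>; as \<open>M\<close> is symmetric, \<open>r\<close> is its rank, the largest size of a
  nonsingular principal submatrix. An entry of \<open>\<A>(G)\<close> is \<open>0\<close> or the minimum of the two eccentricities.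
  Hence \<open>M\<close> is congruent to \<open>I\<close> modulo \<open>c\<close> on every set of vertices whose eccentricities are all divisible
  by \<open>c > 1\<close>, and such a set has at most \<open>r\<close> elements.

  If no vertex is adjacent to all others, then all eccentricities lie between \<open>max 2 (D / 2)\<close> and the
  diameter \<open>D\<close>, and a shortest path of length \<open>D\<close> without its last vertex shows that \<open>D \<le> r\<close>. Covering
  the eccentricities by the multiples of 2 and of 3 if \<open>D \<le> 4\<close>, and of 3, of 4 and of 5 if \<open>D = 5\<close>, gives
  \<open>n \<le> 8\<close> for \<open>r = 4\<close> and \<open>n \<le> 15\<close> for \<open>r = 5\<close>; for \<open>r = 3\<close> and \<open>n \<ge> 4\<close> only \<open>P\<^sub>4\<close> remains.

  If a universal vertex exists, let \<open>W\<close> be the set of all nonuniversal vertices. Row operations reduce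
  \<open>M\<close> to a single \<open>1\<close> and the Seidel matrix of the subgraph on \<open>W\<close>, so \<open>r\<close> is \<open>|W|\<close> or \<open>|W| + 1\<close>, the former iff the Seidel
  matrix is singular. This is impossible for \<open>|W| < 5\<close>, and for \<open>|W| = 5\<close> it happens precisely in
  the switching class of \<open>C\<^sub>5\<close>, whose members without a universal vertex are \<open>C\<^sub>5\<close>, \<open>K\<^sub>1 \<union> P\<^sub>4\<close> and the bull.\<close>

section \<open>Multiplicities of eigenvalues of symmetric matrices\<close>

definition fun_mat :: "('a \<Rightarrow> 'a \<Rightarrow> real) \<Rightarrow> 'a list \<Rightarrow> real mat" where
  "fun_mat f vs = mat (length vs) (length vs) (\<lambda>(i, j). f (vs ! i) (vs ! j))"

text \<open>Nonsingularity of a principal submatrix, phrased by its kernel so that no enumeration of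
  \<open>S\<close> has to be chosen.\<close>

definition nonsing_on :: "('a \<Rightarrow> 'a \<Rightarrow> real) \<Rightarrow> 'a set \<Rightarrow> bool" where
  "nonsing_on f S \<longleftrightarrow> (\<forall>z. (\<forall>u\<in>S. (\<Sum>v\<in>S. f u v * z v) = 0) \<longrightarrow> (\<forall>v\<in>S. z v = 0))"

lemma sum_nth_distinct:
  assumes "distinct vs"
  shows "(\<Sum>i = 0..<length vs. h (vs ! i)) = (\<Sum>v\<in>set vs. h v)"
  using sum.reindex_bij_betw[OF bij_betw_nth[OF assms, of "{0..<length vs}" "set vs"], of h]
  by (simp add: atLeast0LessThan)

lemma nonsing_on_cong:
  assumes "\<And>u v. u \<in> S \<Longrightarrow> v \<in> S \<Longrightarrow> f u v = g u v"
  shows "nonsing_on f S \<longleftrightarrow> nonsing_on g S"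
  using assms unfolding nonsing_on_def by (simp cong: sum.cong)

lemma nonsing_on_iff_det:
  assumes "distinct vs"
  shows "nonsing_on f (set vs) \<longleftrightarrow> det (fun_mat f vs) \<noteq> 0"
proof -
  let ?n = "length vs" and ?A = "fun_mat f vs"
  have A: "?A \<in> carrier_mat ?n ?n" by (simp add: fun_mat_def)
  have idx: "?A *\<^sub>v vec ?n (\<lambda>i. z (vs ! i)) = 0\<^sub>v ?n
      \<longleftrightarrow> (\<forall>u\<in>set vs. (\<Sum>v\<in>set vs. f u v * z v) = 0)" for z
  proof -
    have "(?A *\<^sub>v vec ?n (\<lambda>i. z (vs ! i))) $ i = (\<Sum>v\<in>set vs. f (vs ! i) v * z v)"
      if "i < ?n" for i
      using that sum_nth_distinct[OF assms, of "\<lambda>v. f (vs ! i) v * z v"]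
      by (simp add: fun_mat_def scalar_prod_def)
    moreover have "dim_vec (?A *\<^sub>v vec ?n (\<lambda>i. z (vs ! i))) = ?n" by (simp add: fun_mat_def)
    ultimately show ?thesis unfolding vec_eq_iff all_set_conv_all_nth by simp
  qed
  \<comment> \<open>Every vector of positions comes from a function on the entries of
    \<open>vs\<close>: distinctness makes the position of an entry unique.\<close>
  have rep: "\<exists>z. x = vec ?n (\<lambda>i. z (vs ! i))" if "x \<in> carrier_vec ?n" for x :: "real vec"
  proof
    show "x = vec ?n (\<lambda>i. (\<lambda>v. x $ (THE j. j < ?n \<and> vs ! j = v)) (vs ! i))"
    proof (rule eq_vecI)
      fix i assume "i < dim_vec (vec ?n (\<lambda>i. (\<lambda>v. x $ (THE j. j < ?n \<and> vs ! j = v)) (vs ! i)))"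
      hence i: "i < ?n" by simp
      have "(THE j. j < ?n \<and> vs ! j = vs ! i) = i"
        using i assms by (intro the_equality) (auto simp: nth_eq_iff_index_eq)
      thus "x $ i = vec ?n (\<lambda>i. (\<lambda>v. x $ (THE j. j < ?n \<and> vs ! j = v)) (vs ! i)) $ i"
        using i by simp
    qed (use that in simp)
  qed
  have zero: "vec ?n (\<lambda>i. z (vs ! i)) = 0\<^sub>v ?n \<longleftrightarrow> (\<forall>v\<in>set vs. z v = 0)" for z :: "'a \<Rightarrow> real"
    unfolding vec_eq_iff all_set_conv_all_nth by simp
  have "det ?A = 0 \<longleftrightarrow> (\<exists>x. x \<in> carrier_vec ?n \<and> x \<noteq> 0\<^sub>v ?n \<and> ?A *\<^sub>v x = 0\<^sub>v ?n)"
    by (rule det_0_iff_vec_prod_zero_field[OF A])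
  also have "\<dots> \<longleftrightarrow> (\<exists>z. vec ?n (\<lambda>i. z (vs ! i)) \<noteq> 0\<^sub>v ?n
      \<and> ?A *\<^sub>v vec ?n (\<lambda>i. z (vs ! i)) = 0\<^sub>v ?n)"
    by (metis rep vec_carrier)
  also have "\<dots> \<longleftrightarrow> \<not> nonsing_on f (set vs)"
    unfolding idx zero nonsing_on_def by blast
  finally show ?thesis by blast
qed

section \<open>Eigenvectors, principal submatrices and the characteristic polynomial\<close>

text \<open>Let \<open>P\<close> have the eigenvectors \<open>z v\<close> as columns outside
  \<open>T\<close> and unit vectors as columns in \<open>T\<close>; the normalisation of
  \<open>z\<close> makes it invertible. Then \<open>X * ?P = Q * D\<close>, where the diagonal
  matrix \<open>D\<close> collects one factor x - c for each eigenvector. Determinants give the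
  factorisation with \<open>d = det P\<close>, and \<open>q\<close> is the determinant of
  \<open>Q\<close>, so its value at \<open>c\<close> can be read off entrywise.\<close>

lemma char_poly_eigenvectors_factor:
  fixes f :: "'a \<Rightarrow> 'a \<Rightarrow> real"
  assumes vs: "distinct vs" and T: "T \<subseteq> set vs"
    and z1: "\<And>v. v \<in> set vs - T \<Longrightarrow> z v v = 1"
    and z0: "\<And>u v. v \<in> set vs - T \<Longrightarrow> u \<in> set vs - T \<Longrightarrow> u \<noteq> v \<Longrightarrow> z v u = 0"
    and ev: "\<And>u v. v \<in> set vs - T \<Longrightarrow> u \<in> set vs
      \<Longrightarrow> (\<Sum>w\<in>set vs. f u w * z v w) = c * z v u"
  obtains d q where "d \<noteq> 0"
    "char_poly (fun_mat f vs) * [:d:] = q * [:- c, 1:] ^ (length vs - card T)"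
    "poly q c = det (fun_mat (\<lambda>u v. if v \<in> T then (if u = v then c else 0) - f u v else z v u) vs)"
proof -
  define n where "n = length vs"
  define A where "A = fun_mat f vs"
  have A: "A \<in> carrier_mat n n" by (simp add: A_def fun_mat_def n_def)
  have Aij: "A $$ (i, j) = f (vs ! i) (vs ! j)" if "i < n" "j < n" for i j
    using that by (simp add: A_def fun_mat_def n_def)
  define g where "g = (\<lambda>u v. if v \<in> T then (if u = v then 1 else 0) else z v u)"
  define P where "P = fun_mat g vs"
  have P: "P \<in> carrier_mat n n" by (simp add: P_def fun_mat_def n_def)
  have Pij: "P $$ (i, j) = g (vs ! i) (vs ! j)" if "i < n" "j < n" for i j
    using that by (simp add: P_def fun_mat_def n_def)
  define X where "X = char_poly_matrix A"
  have X: "X \<in> carrier_mat n n" using A by (simp add: X_def)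
  define Q where "Q = mat n n (\<lambda>(i, j). if vs ! j \<in> T then X $$ (i, j) else [: z (vs ! j) (vs ! i) :])"
  define D where "D = mat_diag n (\<lambda>j. if vs ! j \<in> T then 1 else [:- c, 1:])"
  let ?P = "map_mat (\<lambda>a. [:a:]) P"
  have neq: "vs ! i = vs ! j \<longleftrightarrow> i = j" if "i < n" "j < n" for i j
    using that vs by (simp add: n_def nth_eq_iff_index_eq)
  have Xij: "X $$ (i, j) = [: - f (vs ! i) (vs ! j), if i = j then 1 else 0 :]" if "i < n" "j < n" for i j
    using that A by (auto simp: X_def char_poly_matrix_def Aij)
  \<comment> \<open>A column in \<open>T\<close> is just a column of \<open>X\<close>. An
    eigenvector column is multiplied by x - c, which is the corresponding entry of
    \<open>D\<close>.\<close>
  have XP: "X * ?P = Q * D"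
  proof (rule eq_matI)
    fix i j assume "i < dim_row (Q * D)" "j < dim_col (Q * D)"
    hence ij: "i < n" "j < n" by (auto simp: Q_def D_def mat_diag_def)
    have "(X * ?P) $$ (i, j) = (\<Sum>k = 0..<n. X $$ (i, k) * [:P $$ (k, j):])"
      using ij X P by (simp add: scalar_prod_def)
    also have "\<dots> = (\<Sum>k = 0..<n. [: - (f (vs ! i) (vs ! k) * g (vs ! k) (vs ! j)),
        if k = i then g (vs ! k) (vs ! j) else 0 :])"
      using ij by (intro sum.cong) (auto simp: Xij Pij)
    also have "\<dots> = [: - (\<Sum>k = 0..<n. f (vs ! i) (vs ! k) * g (vs ! k) (vs ! j)),
        \<Sum>k = 0..<n. if k = i then g (vs ! k) (vs ! j) else 0 :]"
    proof -
      have "(\<Sum>k\<in>F. [: a k, b k :]) = [: \<Sum>k\<in>F. a k, \<Sum>k\<in>F. b k :]"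
        for a b :: "nat \<Rightarrow> real" and F :: "nat set"
        by (induction F rule: infinite_finite_induct) auto
      thus ?thesis by (simp add: sum_negf)
    qed
    also have "\<dots> = [: - (\<Sum>k = 0..<n. f (vs ! i) (vs ! k) * g (vs ! k) (vs ! j)), g (vs ! i) (vs ! j) :]"
      using ij by simp
    also have "(\<Sum>k = 0..<n. f (vs ! i) (vs ! k) * g (vs ! k) (vs ! j))
        = (\<Sum>w\<in>set vs. f (vs ! i) w * g w (vs ! j))"
      unfolding n_def by (rule sum_nth_distinct[OF vs])
    finally have lhs: "(X * ?P) $$ (i, j)
        = [: - (\<Sum>w\<in>set vs. f (vs ! i) w * g w (vs ! j)), g (vs ! i) (vs ! j) :]" .
    have rhs: "(Q * D) $$ (i, j) = Q $$ (i, j) * (if vs ! j \<in> T then 1 else [:- c, 1:])"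
    proof -
      have Q: "Q \<in> carrier_mat n n" by (simp add: Q_def)
      show ?thesis unfolding D_def mat_diag_mult_right[OF Q] using ij by simp
    qed
    have mem: "vs ! i \<in> set vs" "vs ! j \<in> set vs" using ij by (auto simp: n_def)
    show "(X * ?P) $$ (i, j) = (Q * D) $$ (i, j)"
    proof (cases "vs ! j \<in> T")
      case True
      have "(\<Sum>w\<in>set vs. f (vs ! i) w * g w (vs ! j)) = (\<Sum>w\<in>set vs. if w = vs ! j then f (vs ! i) w else 0)"
        using True by (intro sum.cong) (auto simp: g_def)
      also have "\<dots> = f (vs ! i) (vs ! j)" using mem by simp
      finally show ?thesis unfolding lhs rhs using True ij by (simp add: Q_def Xij g_def neq)
    next
      case False
      have "(\<Sum>w\<in>set vs. f (vs ! i) w * g w (vs ! j)) = c * z (vs ! j) (vs ! i)"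
        using False mem ev[of "vs ! j" "vs ! i"] by (simp add: g_def)
      thus ?thesis unfolding lhs rhs using False ij by (simp add: Q_def g_def)
    qed
  qed (auto simp: Q_def D_def X_def char_poly_matrix_def mat_diag_def A_def fun_mat_def n_def P_def)
  have "det (X * ?P) = det X * det ?P"
    by (rule det_mult[OF X]) (use P in auto)
  moreover have "det ?P = [: det P :]"
  proof -
    interpret h: comm_ring_hom "\<lambda>a :: real. [:a:]" by standard auto
    show ?thesis by (rule h.hom_det)
  qed
  moreover have "det (Q * D) = det Q * det D"
    by (rule det_mult[of _ n]) (auto simp: Q_def D_def)
  moreover have "det D = [:- c, 1:] ^ (n - card T)"
  proof -
    have "det D = prod_list (diag_mat D)"
      by (rule det_upper_triangular) (auto simp: D_def mat_diag_def)
    also have "diag_mat D = map (\<lambda>j. if vs ! j \<in> T then 1 else [:- c, 1:]) [0..<n]"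
      by (auto simp: diag_mat_def D_def mat_diag_def)
    also have "prod_list \<dots> = (\<Prod>j = 0..<n. if vs ! j \<in> T then 1 else [:- c, 1:])"
      by (simp add: prod.list_conv_set_nth atLeast0LessThan)
    also have "\<dots> = (\<Prod>v\<in>set vs. if v \<in> T then 1 else [:- c, 1:])"
      using prod.reindex_bij_betw[OF bij_betw_nth[OF vs, of "{0..<n}" "set vs"],
        of "\<lambda>v. if v \<in> T then 1 else [:- c, 1:]"]
      by (simp add: atLeast0LessThan n_def)
    also have "\<dots> = (\<Prod>v\<in>set vs - T. [:- c, 1:])"
      by (rule prod.mono_neutral_cong_right) auto
    also have "\<dots> = [:- c, 1:] ^ (n - card T)"
      using T vs by (simp add: card_Diff_subset finite_subset distinct_card n_def)
    finally show ?thesis .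
  qed
  ultimately have "det X * [: det P :] = det Q * [:- c, 1:] ^ (n - card T)"
    using XP by metis
  moreover have "det P \<noteq> 0"
  proof -
    have "nonsing_on g (set vs)" unfolding nonsing_on_def
    proof (intro allI impI)
      fix x assume x: "\<forall>u\<in>set vs. (\<Sum>v\<in>set vs. g u v * x v) = 0"
      have out: "x v = 0" if "v \<in> set vs - T" for v
      proof -
        have "(\<Sum>w\<in>set vs. g v w * x w) = (\<Sum>w\<in>set vs. if w = v then x w else 0)"
          using that z1 z0 by (intro sum.cong) (auto simp: g_def)
        also have "\<dots> = x v" using that by simp
        finally show ?thesis using x that by auto
      qed
      show "\<forall>v\<in>set vs. x v = 0"
      proof
        fix v assume v: "v \<in> set vs"
        show "x v = 0"
        proof (cases "v \<in> T")
          case True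
          have "(\<Sum>w\<in>set vs. g v w * x w) = (\<Sum>w\<in>set vs. if w = v then x w else 0)"
            using True out by (intro sum.cong) (auto simp: g_def)
          also have "\<dots> = x v" using v by simp
          finally show ?thesis using x v by auto
        qed (use out v in auto)
      qed
    qed
    thus ?thesis by (simp add: nonsing_on_iff_det[OF vs] P_def)
  qed
  moreover have "poly (det Q) c
      = det (fun_mat (\<lambda>u v. if v \<in> T then (if u = v then c else 0) - f u v else z v u) vs)"
    (is "_ = det ?F")
  proof -
    have hom: "comm_ring_hom (\<lambda>p. poly p c)" by standard auto
    have "map_mat (\<lambda>p. poly p c) Q = ?F"
      by (rule eq_matI) (auto simp: Q_def Xij fun_mat_def n_def[symmetric] neq)
    thus ?thesis using comm_ring_hom.hom_det[OF hom, of Q] by simp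
  qed
  ultimately show thesis using that[of "det P" "det Q"]
    by (simp add: X_def A_def char_poly_def n_def)
qed

lemma fun_mat_char_poly_nonzero: "char_poly (fun_mat f vs) \<noteq> 0"
  using degree_monic_char_poly[of "fun_mat f vs" "length vs"] by (force simp: fun_mat_def)

text \<open>Geometric multiplicity is at most algebraic multiplicity: the power of x - c in the
  factorisation divides the characteristic polynomial because \<open>d\<close> is a nonzero
  constant.\<close>

theorem eigenvectors_le_multiplicity:
  fixes f :: "'a \<Rightarrow> 'a \<Rightarrow> real"
  assumes vs: "distinct vs" and T: "T \<subseteq> set vs"
    and z1: "\<And>v. v \<in> set vs - T \<Longrightarrow> z v v = 1"
    and z0: "\<And>u v. v \<in> set vs - T \<Longrightarrow> u \<in> set vs - T \<Longrightarrow> u \<noteq> v \<Longrightarrow> z v u = 0"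
    and ev: "\<And>u v. v \<in> set vs - T \<Longrightarrow> u \<in> set vs
      \<Longrightarrow> (\<Sum>w\<in>set vs. f u w * z v w) = c * z v u"
  shows "length vs \<le> eigenvalue_multiplicity (fun_mat f vs) c + card T"
proof -
  obtain d q where d: "d \<noteq> 0" and
    eq: "char_poly (fun_mat f vs) * [:d:] = q * [:- c, 1:] ^ (length vs - card T)"
    by (rule char_poly_eigenvectors_factor[OF assms]) auto
  have "[:- c, 1:] ^ (length vs - card T) dvd char_poly (fun_mat f vs) * [:d:]"
    unfolding eq by simp
  hence "[:- c, 1:] ^ (length vs - card T) dvd char_poly (fun_mat f vs)"
    using d by (simp add: dvd_smult_iff)
  from order_max[OF this fun_mat_char_poly_nonzero]
  show ?thesis by (simp add: eigenvalue_multiplicity_def)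
qed

text \<open>For symmetric matrices the multiplicity of \<open>c\<close> is n minus the rank of A -
  cI. The set \<open>S\<close> is enlarged to a maximal nonsingular \<open>T\<close>, kernel vectors
  are built for all vertices outside \<open>T\<close>, and the cofactor \<open>q\<close> of the
  factorisation is shown not to vanish at \<open>c\<close>. Hence the multiplicity is exactly n -
  |T|.\<close>

theorem multiplicity_add_card_nonsing_le:
  fixes f :: "'a \<Rightarrow> 'a \<Rightarrow> real"
  assumes vs: "distinct vs" and sym: "\<And>u v. u \<in> set vs \<Longrightarrow> v \<in> set vs \<Longrightarrow> f u v = f v u"
    and S: "S \<subseteq> set vs" and ns: "nonsing_on (\<lambda>u v. f u v - (if u = v then c else 0)) S"
  shows "eigenvalue_multiplicity (fun_mat f vs) c + card S \<le> length vs"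
proof -
  define g where "g = (\<lambda>u v. f u v - (if u = v then c else 0))"
  have gsym: "g u v = g v u" if "u \<in> set vs" "v \<in> set vs" for u v
    using sym[OF that] by (simp add: g_def)
  define \<S> where "\<S> = {S'. S \<subseteq> S' \<and> S' \<subseteq> set vs \<and> nonsing_on g S'}"
  have "finite \<S>" by (rule finite_subset[of _ "Pow (set vs)"]) (auto simp: \<S>_def)
  moreover have "S \<in> \<S>" using S ns by (simp add: \<S>_def g_def)
  ultimately obtain T where T: "T \<in> \<S>" and max: "\<And>S'. S' \<in> \<S> \<Longrightarrow> T \<subseteq> S' \<Longrightarrow> S' = T"
    using finite_has_maximal2[of \<S> S] by metis
  have TV: "T \<subseteq> set vs" "S \<subseteq> T" and nsT: "nonsing_on g T" using T by (auto simp: \<S>_def)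
  have finT: "finite T" using TV finite_subset by auto
  have sing: "\<not> nonsing_on g S'" if "T \<subset> S'" "S' \<subseteq> set vs" for S'
    using max[of S'] that TV by (auto simp: \<S>_def)
  have restr: "(\<Sum>w\<in>set vs. g u w * x w) = (\<Sum>w\<in>U. g u w * x w)"
    if "U \<subseteq> set vs" "\<And>w. w \<notin> U \<Longrightarrow> x w = 0" for U x u
    using that by (intro sum.mono_neutral_right) auto
  \<comment> \<open>By maximality \<open>g\<close> is singular on \<open>insert v T\<close>. A
    kernel vector there cannot vanish at \<open>v\<close>, since \<open>g\<close> is nonsingular on
    \<open>T\<close>, and so it can be scaled to 1 at \<open>v\<close>.\<close>
  have "\<exists>x. x v = 1 \<and> (\<forall>w. w \<notin> insert v T \<longrightarrow> x w = 0)
      \<and> (\<forall>u\<in>insert v T. (\<Sum>w\<in>set vs. g u w * x w) = 0)" if v: "v \<in> set vs - T" for v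
  proof -
    have "\<not> nonsing_on g (insert v T)" using sing[of "insert v T"] v TV by auto
    then obtain y where y: "\<forall>u\<in>insert v T. (\<Sum>w\<in>insert v T. g u w * y w) = 0"
      and ynz: "\<exists>w\<in>insert v T. y w \<noteq> 0"
      unfolding nonsing_on_def by blast
    have "y v \<noteq> 0"
    proof
      assume "y v = 0"
      hence "\<forall>u\<in>T. (\<Sum>w\<in>T. g u w * y w) = 0" using y v finT by simp
      hence "\<forall>w\<in>T. y w = 0" using nsT unfolding nonsing_on_def by blast
      thus False using ynz \<open>y v = 0\<close> by auto
    qed
    define x where "x = (\<lambda>w. if w \<in> insert v T then y w / y v else 0)"
    have "(\<Sum>w\<in>set vs. g u w * x w) = 0" if "u \<in> insert v T" for u
    proof -
      have "(\<Sum>w\<in>set vs. g u w * x w) = (\<Sum>w\<in>insert v T. g u w * x w)"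
        using v TV by (intro restr) (auto simp: x_def)
      also have "\<dots> = (\<Sum>w\<in>insert v T. g u w * y w) / y v"
        unfolding sum_divide_distrib by (intro sum.cong) (auto simp: x_def)
      also have "\<dots> = 0" unfolding bspec[OF y that] by simp
      finally show ?thesis .
    qed
    thus ?thesis using \<open>y v \<noteq> 0\<close> by (intro exI[of _ x]) (auto simp: x_def)
  qed
  then obtain z where z1: "\<And>v. v \<in> set vs - T \<Longrightarrow> z v v = 1"
    and z0: "\<And>v w. v \<in> set vs - T \<Longrightarrow> w \<notin> insert v T \<Longrightarrow> z v w = 0"
    and zT: "\<And>v u. v \<in> set vs - T \<Longrightarrow> u \<in> insert v T \<Longrightarrow> (\<Sum>w\<in>set vs. g u w * z v w) = 0"
    by metis
  text \<open>For \<open>u\<close> and \<open>v\<close> outside \<open>T\<close>, the entries \<open>(g z\<^sub>v) u\<close> form the Schur complement of \<open>T\<close>. Its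
    diagonal and hence, by its \<open>2\<times>2\<close> minors, all of it vanishes because \<open>T\<close> is maximal.\<close>
  have ker: "(\<Sum>w\<in>set vs. g u w * z v w) = 0" if v: "v \<in> set vs - T" and u: "u \<in> set vs" for u v
  proof (cases "u \<in> insert v T")
    case False
    define s where "s = (\<Sum>w\<in>set vs. g u w * z v w)"
    have uT: "u \<in> set vs - T" using u False by auto
    \<comment> \<open>The bilinear form of \<open>g\<close> at \<open>z p\<close> and
      \<open>z q\<close> picks out a single entry: \<open>z p\<close> is supported on
      \<open>insert p T\<close> with value 1 at \<open>p\<close>, and \<open>g\<close> applied to
      \<open>z q\<close> vanishes on \<open>T\<close>. Its symmetry then gives
      \<open>s'\<close>.\<close>
    have pair: "(\<Sum>a\<in>set vs. z p a * (\<Sum>w\<in>set vs. g a w * z q w)) = (\<Sum>w\<in>set vs. g p w * z q w)"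
      if "p \<in> set vs - T" "q \<in> set vs - T" for p q
    proof -
      have "(\<Sum>a\<in>set vs. z p a * (\<Sum>w\<in>set vs. g a w * z q w))
          = (\<Sum>a\<in>set vs. if a = p then \<Sum>w\<in>set vs. g a w * z q w else 0)"
        using that z1 z0 zT by (intro sum.cong) (auto, metis insertCI insertE)
      thus ?thesis using that by simp
    qed
    have s': "(\<Sum>w\<in>set vs. g v w * z u w) = s"
    proof -
      have "(\<Sum>w\<in>set vs. g v w * z u w) = (\<Sum>a\<in>set vs. \<Sum>w\<in>set vs. z v a * (g a w * z u w))"
        using pair[OF v uT] by (simp add: sum_distrib_left)
      also have "\<dots> = (\<Sum>w\<in>set vs. \<Sum>a\<in>set vs. z v a * (g a w * z u w))" by (rule sum.swap)
      also have "\<dots> = (\<Sum>w\<in>set vs. z u w * (\<Sum>a\<in>set vs. g w a * z v a))"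
        unfolding sum_distrib_left by (intro sum.cong refl) (simp add: gsym)
      also have "\<dots> = s" using pair[OF uT v] by (simp add: s_def)
      finally show ?thesis .
    qed
    have "s = 0"
    proof (rule ccontr)
      assume "s \<noteq> 0"
      let ?U = "insert u (insert v T)"
      have UV: "?U \<subseteq> set vs" using u v TV by auto
      have "nonsing_on g ?U" unfolding nonsing_on_def
      proof (intro allI impI)
        fix x0 assume x0: "\<forall>a\<in>?U. (\<Sum>w\<in>?U. g a w * x0 w) = 0"
        define x where "x = (\<lambda>w. if w \<in> ?U then x0 w else 0)"
        have x: "(\<Sum>w\<in>set vs. g a w * x w) = 0" if "a \<in> ?U" for a
        proof -
          have "(\<Sum>w\<in>set vs. g a w * x w) = (\<Sum>w\<in>?U. g a w * x w)"
            using UV by (intro restr) (auto simp: x_def)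
          also have "\<dots> = (\<Sum>w\<in>?U. g a w * x0 w)" by (intro sum.cong) (auto simp: x_def)
          also have "\<dots> = 0" by (rule bspec[OF x0 that])
          finally show ?thesis .
        qed
        \<comment> \<open>Subtracting multiples of \<open>z v\<close> and \<open>z u\<close> moves
          the support of a kernel vector into \<open>T\<close>, where \<open>g\<close> is
          nonsingular, so nothing remains. Rows \<open>v\<close> and \<open>u\<close> then read
          \<open>x u * s = 0\<close> and \<open>x v * s = 0\<close>.\<close>
        define y where "y = (\<lambda>w. x w - x v * z v w - x u * z u w)"
        have y0: "y w = 0" if "w \<notin> T" for w
          using that False z1 z0 uT v by (cases "w = u"; cases "w = v") (auto simp: y_def x_def)
        have gy: "(\<Sum>w\<in>set vs. g a w * y w) = (\<Sum>w\<in>set vs. g a w * x w)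
            - x v * (\<Sum>w\<in>set vs. g a w * z v w) - x u * (\<Sum>w\<in>set vs. g a w * z u w)" for a
          unfolding sum_distrib_left sum_subtractf[symmetric] y_def
          by (intro sum.cong refl) (simp add: algebra_simps)
        have "(\<Sum>w\<in>T. g a w * y w) = 0" if "a \<in> T" for a
          using gy[of a] x[of a] zT[OF v, of a] zT[OF uT, of a] that restr[of T y a] y0 TV by simp
        hence "\<forall>w\<in>T. y w = 0" using nsT unfolding nonsing_on_def by blast
        hence y: "y w = 0" for w using y0 by blast
        have "x u * s = 0" using gy[of v] x[of v] zT[OF v, of v] s' y by simp
        moreover have "x v * s = 0" using gy[of u] x[of u] zT[OF uT, of u] y by (simp add: s_def)
        ultimately have "x u = 0" "x v = 0" using \<open>s \<noteq> 0\<close> by auto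
        hence "x w = 0" for w using y[of w] by (simp add: y_def)
        thus "\<forall>w\<in>?U. x0 w = 0" unfolding x_def by metis
      qed
      moreover have "T \<subset> ?U" using v by auto
      ultimately show False using sing UV by blast
    qed
    thus ?thesis by (simp add: s_def)
  qed (use zT v in blast)
  have ev: "(\<Sum>w\<in>set vs. f u w * z v w) = c * z v u" if "v \<in> set vs - T" "u \<in> set vs" for u v
  proof -
    have "(\<Sum>w\<in>set vs. f u w * z v w)
        = (\<Sum>w\<in>set vs. g u w * z v w) + (\<Sum>w\<in>set vs. if w = u then c * z v w else 0)"
      unfolding sum.distrib[symmetric] by (intro sum.cong) (auto simp: g_def algebra_simps)
    thus ?thesis using ker[OF that] that by simp
  qed
  obtain d q where d: "d \<noteq> 0"
    and eq: "char_poly (fun_mat f vs) * [:d:] = q * [:- c, 1:] ^ (length vs - card T)"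
    and qc: "poly q c = det (fun_mat (\<lambda>u v. if v \<in> T then (if u = v then c else 0) - f u v else z v u) vs)"
    by (rule char_poly_eigenvectors_factor[OF vs TV(1), of z f c]) (use z1 z0 ev in auto)
  have h: "(\<lambda>u v. if v \<in> T then (if u = v then c else 0) - f u v else z v u)
      = (\<lambda>u v. if v \<in> T then - g u v else z v u)"
    by (auto simp: g_def fun_eq_iff)
  \<comment> \<open>This gives \<open>poly q c \<noteq> 0\<close>. A linear relation among the
    columns equates a combination \<open>y\<close> of the kernel vectors with an element of the
    image of \<open>g\<close>. For symmetric \<open>g\<close> kernel and image are orthogonal, so
    \<open>y\<close> is orthogonal to itself and vanishes.\<close>
  have "nonsing_on (\<lambda>u v. if v \<in> T then - g u v else z v u) (set vs)"
    unfolding nonsing_on_def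
  proof (intro allI impI)
    fix x assume x: "\<forall>u\<in>set vs. (\<Sum>v\<in>set vs. (if v \<in> T then - g u v else z v u) * x v) = 0"
    define y where "y = (\<lambda>u. \<Sum>v\<in>set vs - T. x v * z v u)"
    have yT: "y u = (\<Sum>v\<in>T. g u v * x v)" if "u \<in> set vs" for u
    proof -
      have "(\<Sum>v\<in>set vs. (if v \<in> T then - g u v else z v u) * x v)
          = (\<Sum>v\<in>set vs - T. (if v \<in> T then - g u v else z v u) * x v)
            + (\<Sum>v\<in>T. (if v \<in> T then - g u v else z v u) * x v)"
        by (rule sum.subset_diff[OF TV(1)]) simp
      also have "(\<Sum>v\<in>set vs - T. (if v \<in> T then - g u v else z v u) * x v) = y u"
        unfolding y_def by (intro sum.cong) auto
      also have "(\<Sum>v\<in>T. (if v \<in> T then - g u v else z v u) * x v) = - (\<Sum>v\<in>T. g u v * x v)"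
        unfolding sum_negf[symmetric] by (intro sum.cong) auto
      finally show ?thesis using x that by simp
    qed
    have gy: "(\<Sum>u\<in>set vs. g v u * y u) = 0" if "v \<in> set vs" for v
    proof -
      have "(\<Sum>u\<in>set vs. g v u * y u) = (\<Sum>u\<in>set vs. \<Sum>w\<in>set vs - T. x w * (g v u * z w u))"
        unfolding y_def sum_distrib_left by (intro sum.cong refl) simp
      also have "\<dots> = (\<Sum>w\<in>set vs - T. x w * (\<Sum>u\<in>set vs. g v u * z w u))"
        unfolding sum_distrib_left by (rule sum.swap)
      also have "\<dots> = 0" using ker that by simp
      finally show ?thesis .
    qed
    have "(\<Sum>u\<in>set vs. y u * y u) = (\<Sum>u\<in>set vs. \<Sum>v\<in>T. x v * (g u v * y u))"
      unfolding sum_distrib_left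
      by (intro sum.cong refl) (simp add: yT sum_distrib_left sum_distrib_right algebra_simps)
    also have "\<dots> = (\<Sum>v\<in>T. \<Sum>u\<in>set vs. x v * (g u v * y u))" by (rule sum.swap)
    also have "\<dots> = (\<Sum>v\<in>T. x v * (\<Sum>u\<in>set vs. g v u * y u))"
      unfolding sum_distrib_left using TV by (intro sum.cong refl) (auto simp: gsym)
    also have "\<dots> = 0" using gy TV by (intro sum.neutral) auto
    finally have y0: "y u = 0" if "u \<in> set vs" for u
      using that by (simp add: sum_nonneg_eq_0_iff)
    have out: "x v = 0" if "v \<in> set vs - T" for v
    proof -
      have "y v = (\<Sum>w\<in>set vs - T. if w = v then x w else 0)"
        unfolding y_def using that z1 z0 by (intro sum.cong) auto
      thus ?thesis using y0[of v] that by simp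
    qed
    have "\<forall>u\<in>T. (\<Sum>v\<in>T. g u v * x v) = 0" using yT y0 TV by auto
    hence "\<forall>v\<in>T. x v = 0" using nsT unfolding nonsing_on_def by blast
    thus "\<forall>v\<in>set vs. x v = 0" using out by blast
  qed
  hence "poly q c \<noteq> 0" unfolding qc h nonsing_on_iff_det[OF vs] .
  moreover from this have "q \<noteq> 0" by auto
  ultimately have "order c (q * [:- c, 1:] ^ (length vs - card T)) = length vs - card T"
    by (subst order_mult) (auto simp: order_power_n_n order_0I)
  moreover have "order c (char_poly (fun_mat f vs) * [:d:]) = order c (char_poly (fun_mat f vs))"
    using d fun_mat_char_poly_nonzero[of f vs] by (subst order_mult) (auto simp: order_0I)
  ultimately have "eigenvalue_multiplicity (fun_mat f vs) c = length vs - card T"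
    unfolding eq eigenvalue_multiplicity_def by simp
  moreover have "card S \<le> card T" using TV finT by (simp add: card_mono)
  moreover have "card T \<le> length vs" using TV vs by (metis card_mono distinct_card finite_set)
  ultimately show ?thesis by linarith
qed

section \<open>Integer matrices congruent to the identity\<close>

text \<open>In the Leibniz expansion every permutation other than the identity meets an off-diagonal
  entry, which is divisible by \<open>c\<close>. So the determinant is 1 modulo \<open>c\<close> and
  cannot be zero.\<close>

lemma nonsing_on_cong_one:
  fixes g :: "'a \<Rightarrow> 'a \<Rightarrow> int"
  assumes fin: "finite S" and c: "c > 1"
    and diag: "\<And>u. u \<in> S \<Longrightarrow> [g u u = 1] (mod c)"
    and off: "\<And>u v. u \<in> S \<Longrightarrow> v \<in> S \<Longrightarrow> u \<noteq> v \<Longrightarrow> c dvd g u v"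
  shows "nonsing_on (\<lambda>u v. real_of_int (g u v)) S"
proof -
  obtain vs where vs: "set vs = S" "distinct vs" using finite_distinct_list[OF fin] by blast
  define n where "n = length vs"
  define B where "B = mat n n (\<lambda>(i, j). g (vs ! i) (vs ! j))"
  have B: "B \<in> carrier_mat n n" by (simp add: B_def)
  have mem: "vs ! i \<in> S" if "i < n" for i using that vs by (auto simp: n_def)
  have "[det B = (\<Sum>p\<in>{p. p permutes {0..<n}}. if p = id then 1 else 0)] (mod c)"
    unfolding det_def'[OF B]
  proof (rule cong_sum)
    fix p assume "p \<in> {p. p permutes {0..<n}}"
    hence p: "p permutes {0..<n}" by simp
    show "[signof p * (\<Prod>i = 0..<n. B $$ (i, p i)) = (if p = id then 1 else 0)] (mod c)"
    proof (cases "p = id")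
      case True
      have "[(\<Prod>i = 0..<n. B $$ (i, i)) = (\<Prod>i = 0..<n. 1)] (mod c)"
        by (rule cong_prod) (auto simp: B_def intro!: diag mem)
      thus ?thesis using True by simp
    next
      case False
      then obtain i where i: "p i \<noteq> i" by (auto simp: fun_eq_iff)
      hence "i < n" "p i < n" using p permutes_not_in[OF p] permutes_in_image[OF p] by fastforce+
      hence "c dvd B $$ (i, p i)"
        using i vs by (auto simp: B_def n_def nth_eq_iff_index_eq intro!: off)
      hence "c dvd (\<Prod>i = 0..<n. B $$ (i, p i))"
        by (rule dvd_trans) (use \<open>i < n\<close> in \<open>auto intro!: dvd_prodI\<close>)
      thus ?thesis using False by (simp add: cong_0_iff)
    qed
  qed
  moreover have "(\<Sum>p\<in>{p. p permutes {0..<n}}. if p = id then 1 else 0) = (1::int)"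
    by (simp add: finite_permutations permutes_id)
  ultimately have "[det B = 1] (mod c)" by simp
  hence "det B \<noteq> 0" using c by (auto simp: cong_def)
  moreover have "fun_mat (\<lambda>u v. real_of_int (g u v)) vs = map_mat real_of_int B"
    by (rule eq_matI) (auto simp: fun_mat_def B_def n_def)
  ultimately have "det (fun_mat (\<lambda>u v. real_of_int (g u v)) vs) \<noteq> 0"
    by (simp add: of_int_hom.hom_det)
  thus ?thesis using nonsing_on_iff_det[OF vs(2)] vs(1) by metis
qed

section \<open>Distances in a connected graph\<close>

text \<open>Axioms of the distance in a connected graph, whose edges are the pairs at distance 1.
  The spectral argument needs no more than this and stays free of walks.\<close>

locale graph_distance =
  fixes V :: "'a set" and d :: "'a \<Rightarrow> 'a \<Rightarrow> nat"
  assumes finite: "finite V" and nonempty: "V \<noteq> {}"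
    and d_eq_0: "u \<in> V \<Longrightarrow> v \<in> V \<Longrightarrow> d u v = 0 \<longleftrightarrow> u = v"
    and sym: "u \<in> V \<Longrightarrow> v \<in> V \<Longrightarrow> d u v = d v u"
    and triangle: "u \<in> V \<Longrightarrow> v \<in> V \<Longrightarrow> w \<in> V \<Longrightarrow> d u w \<le> d u v + d v w"
    and shortest_path: "u \<in> V \<Longrightarrow> v \<in> V \<Longrightarrow> \<exists>p. p 0 = u \<and> p (d u v) = v \<and>
        (\<forall>i\<le>d u v. p i \<in> V) \<and> (\<forall>i<d u v. d (p i) (p (Suc i)) = 1)"
begin

definition ecc :: "'a \<Rightarrow> nat" where
  "ecc v = Max ((\<lambda>u. d u v) ` V)"

definition far :: "'a \<Rightarrow> 'a \<Rightarrow> nat" where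
  "far u v = (if d u v = min (ecc u) (ecc v) then d u v else 0)"

text \<open>The entries of the matrix M, that is, the eccentricity matrix plus the identity, kept as
  integers so that congruences apply.\<close>

definition shifted :: "'a \<Rightarrow> 'a \<Rightarrow> int" where
  "shifted u v = int (far u v) + (if u = v then 1 else 0)"

lemma d_le_ecc: "u \<in> V \<Longrightarrow> v \<in> V \<Longrightarrow> d u v \<le> ecc v"
  unfolding ecc_def by (rule Max_ge) (auto simp: finite)

lemma ecc_attained: "\<exists>u\<in>V. d u v = ecc v"
proof -
  have "ecc v \<in> (\<lambda>u. d u v) ` V"
    unfolding ecc_def by (rule Max_in) (use finite nonempty in auto)
  thus ?thesis by (auto simp: eq_commute)
qed

lemma d_self [simp]: "u \<in> V \<Longrightarrow> d u u = 0"
  using d_eq_0 by simp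

lemma far_sym: "u \<in> V \<Longrightarrow> v \<in> V \<Longrightarrow> far u v = far v u"
  unfolding far_def using sym by (simp add: min.commute)

lemma far_self [simp]: "u \<in> V \<Longrightarrow> far u u = 0"
  by (simp add: far_def)

lemma far_cases: "far u v = 0 \<or> far u v = min (ecc u) (ecc v)"
  by (auto simp: far_def)

lemma shifted_sym: "u \<in> V \<Longrightarrow> v \<in> V \<Longrightarrow> shifted u v = shifted v u"
  unfolding shifted_def using far_sym by auto

text \<open>An off-diagonal entry is 0 or one of two eccentricities that \<open>c\<close> divides,
  so M is the identity modulo \<open>c\<close> on \<open>S\<close>.\<close>

lemma nonsing_on_if_dvd_ecc:
  assumes S: "S \<subseteq> V" and c: "c > 1" and dvd: "\<And>v. v \<in> S \<Longrightarrow> c dvd ecc v"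
  shows "nonsing_on (\<lambda>u v. real_of_int (shifted u v)) S"
proof (rule nonsing_on_cong_one[where c = "int c"])
  show "finite S" using S finite finite_subset by blast
  show "[shifted u u = 1] (mod int c)" if "u \<in> S" for u
    using that S by (auto simp: shifted_def)
  show "int c dvd shifted u v" if "u \<in> S" "v \<in> S" "u \<noteq> v" for u v
    using far_cases[of u v] dvd[OF that(1)] dvd[OF that(2)] that(3)
    by (auto simp: shifted_def min_def)
qed (use c in simp)

lemma d_le_steps:
  assumes "\<And>i. i \<le> n \<Longrightarrow> p i \<in> V" "\<And>i. i < n \<Longrightarrow> d (p i) (p (Suc i)) = 1"
    and "i \<le> j" "j \<le> n"
  shows "d (p i) (p j) \<le> j - i"
  using assms(3,4)
proof (induction j rule: dec_induct)
  case base
  thus ?case using assms(1)[of i] by simp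
next
  case (step k)
  have "d (p i) (p (Suc k)) \<le> d (p i) (p k) + d (p k) (p (Suc k))"
    using step assms(1) by (intro triangle) auto
  thus ?case using step assms(2)[of k] by simp
qed

text \<open>The three segments of a shortest path cut at \<open>p i\<close> and \<open>p j\<close>
  have at most their numbers of steps as distances, and these must add up to at least
  \<open>d u v\<close>; hence all are exact.\<close>

lemma geodesic:
  assumes "u \<in> V" "v \<in> V"
  obtains p where "p 0 = u" "p (d u v) = v" "\<And>i. i \<le> d u v \<Longrightarrow> p i \<in> V"
    "\<And>i j. i \<le> j \<Longrightarrow> j \<le> d u v \<Longrightarrow> d (p i) (p j) = j - i"
proof -
  obtain p where p: "p 0 = u" "p (d u v) = v" "\<And>i. i \<le> d u v \<Longrightarrow> p i \<in> V"
    "\<And>i. i < d u v \<Longrightarrow> d (p i) (p (Suc i)) = 1"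
    using shortest_path[OF assms] by blast
  have "d (p i) (p j) = j - i" if "i \<le> j" "j \<le> d u v" for i j
  proof -
    note le = d_le_steps[of "d u v" p, OF p(3,4)]
    have V: "p 0 \<in> V" "p i \<in> V" "p j \<in> V" "p (d u v) \<in> V" using p(3) that by auto
    have "d u v \<le> d (p 0) (p i) + d (p i) (p (d u v))" using triangle V p(1,2) by metis
    moreover have "d (p i) (p (d u v)) \<le> d (p i) (p j) + d (p j) (p (d u v))"
      using triangle V by metis
    ultimately show ?thesis using le[of 0 i] le[of i j] le[of j "d u v"] that by linarith
  qed
  thus thesis using that p by blast
qed

section \<open>Diameter and universal vertices\<close>

definition diam :: nat where
  "diam = Max (ecc ` V)"

lemma ecc_le_diam: "v \<in> V \<Longrightarrow> ecc v \<le> diam"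
  unfolding diam_def by (rule Max_ge) (auto simp: finite)

lemma diam_attained: "\<exists>u\<in>V. \<exists>v\<in>V. d u v = diam"
proof -
  have "diam \<in> ecc ` V"
    unfolding diam_def by (rule Max_in) (use finite nonempty in auto)
  then obtain v where "v \<in> V" "diam = ecc v" by blast
  thus ?thesis using ecc_attained[of v] by metis
qed

text \<open>Two vertices at distance \<open>diam\<close> are compared by the triangle inequality
  through \<open>v\<close>.\<close>

lemma diam_le_double_ecc: "v \<in> V \<Longrightarrow> diam \<le> 2 * ecc v"
  using diam_attained triangle[of _ v] d_le_ecc[of _ v] sym[of v]
  by (smt (verit) add_mono le_trans mult_2)

definition universal :: "'a \<Rightarrow> bool" where
  "universal u \<longleftrightarrow> u \<in> V \<and> (\<forall>v\<in>V. v \<noteq> u \<longrightarrow> d u v = 1)"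

lemma two_le_ecc:
  assumes "v \<in> V" "\<not> universal v"
  shows "2 \<le> ecc v"
proof -
  obtain w where w: "w \<in> V" "w \<noteq> v" "d v w \<noteq> 1" using assms by (auto simp: universal_def)
  hence "d v w \<noteq> 0" using d_eq_0 assms by auto
  thus ?thesis using d_le_ecc[OF w(1) assms(1)] w sym[of v w] assms by auto
qed

end

section \<open>Graphs without a universal vertex\<close>

context graph_distance begin

abbreviation nonsing :: "'a set \<Rightarrow> bool" where
  "nonsing S \<equiv> nonsing_on (\<lambda>u v. real_of_int (shifted u v)) S"

lemma shifted_self [simp]: "u \<in> V \<Longrightarrow> shifted u u = 1"
  by (simp add: shifted_def)

lemma shifted_cases:
  assumes "u \<noteq> v"
  shows "shifted u v = 0 \<or> shifted u v = int (min (ecc u) (ecc v))"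
  using far_cases[of u v] assms by (auto simp: shifted_def)

lemma diam_ge_2:
  assumes "\<And>v. \<not> universal v"
  shows "2 \<le> diam"
  using nonempty two_le_ecc ecc_le_diam assms by (meson all_not_in_conv le_trans)

text \<open>M is the identity on \<open>S\<close>, so eliminating \<open>S\<close> leaves the scalar
  1 minus the sum of the squares of the entries \<open>shifted u v\<close>. These entries are 0 or
  at least 2, so that the sum is 0 or at least 4 and never 1.\<close>

lemma nonsing_star:
  assumes u: "u \<in> V" "u \<notin> S" and S: "S \<subseteq> V"
    and indep: "\<And>v w. v \<in> S \<Longrightarrow> w \<in> S \<Longrightarrow> v \<noteq> w \<Longrightarrow> shifted v w = 0"
    and spokes: "\<And>v. v \<in> S \<Longrightarrow> shifted u v = 0 \<or> shifted u v \<ge> 2"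
  shows "nonsing (insert u S)"
  unfolding nonsing_on_def
proof (intro allI impI)
  fix x :: "'a \<Rightarrow> real"
  assume x: "\<forall>v\<in>insert u S. (\<Sum>w\<in>insert u S. shifted v w * x w) = 0"
  have fin: "finite S" using S finite finite_subset by blast
  have spoke: "x v = - shifted u v * x u" if "v \<in> S" for v
  proof -
    have "(\<Sum>w\<in>S. shifted v w * x w) = (\<Sum>w\<in>S. if w = v then x w else 0)"
      using that S indep by (intro sum.cong) auto
    hence "(\<Sum>w\<in>S. shifted v w * x w) = x v" using fin that by simp
    moreover have "(\<Sum>w\<in>insert u S. shifted v w * x w) = 0" using x that by blast
    moreover have "shifted v u = shifted u v" using that S u shifted_sym by blast
    ultimately show ?thesis using fin u by simp
  qed
  have "(\<Sum>w\<in>S. shifted u w * x w) = - (\<Sum>w\<in>S. (shifted u w)\<^sup>2) * x u"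
    unfolding of_int_sum sum_distrib_right sum_negf[symmetric]
    by (intro sum.cong) (auto simp: spoke power2_eq_square sum_distrib_right sum_negf)
  hence "(1 - (\<Sum>w\<in>S. (shifted u w)\<^sup>2)) * x u = 0"
    using bspec[OF x, of u] fin u by (simp add: algebra_simps)
  moreover have "(\<Sum>w\<in>S. (shifted u w)\<^sup>2) \<noteq> 1"
  proof (cases "\<forall>w\<in>S. shifted u w = 0")
    case False
    then obtain w where w: "w \<in> S" "shifted u w \<ge> 2" using spokes by blast
    hence "2\<^sup>2 \<le> (shifted u w)\<^sup>2" by (intro power_mono) auto
    also have "\<dots> \<le> (\<Sum>w\<in>S. (shifted u w)\<^sup>2)" using fin w by (intro member_le_sum) auto
    finally show ?thesis by simp
  qed simp
  hence "real_of_int (1 - (\<Sum>w\<in>S. (shifted u w)\<^sup>2)) \<noteq> 0" by linarith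
  ultimately have "x u = 0" by simp
  thus "\<forall>v\<in>insert u S. x v = 0" using spoke by simp
qed

lemma diam_path:
  obtains p where "\<And>i. i \<le> diam \<Longrightarrow> p i \<in> V"
    "\<And>i j. i \<le> j \<Longrightarrow> j \<le> diam \<Longrightarrow> d (p i) (p j) = j - i" "inj_on p {..diam}"
proof -
  obtain u v where uv: "u \<in> V" "v \<in> V" "d u v = diam" using diam_attained by blast
  obtain p where p: "\<And>i. i \<le> d u v \<Longrightarrow> p i \<in> V"
    "\<And>i j. i \<le> j \<Longrightarrow> j \<le> d u v \<Longrightarrow> d (p i) (p j) = j - i"
    using geodesic[OF uv(1,2)] by metis
  have eq: "i = j" if "i \<le> j" "j \<le> diam" "p i = p j" for i j
  proof -
    have "d (p j) (p j) = j - i" using p(2)[of i j] that uv(3) by metis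
    moreover have "d (p j) (p j) = 0" using p(1)[of j] that(2) uv(3) d_self by metis
    ultimately show ?thesis using that(1) by simp
  qed
  have "inj_on p {..diam}"
  proof (rule inj_onI)
    fix i j assume ij: "i \<in> {..diam}" "j \<in> {..diam}" "p i = p j"
    show "i = j"
    proof (cases "i \<le> j")
      case True
      thus ?thesis using eq[of i j] ij by simp
    next
      case False
      thus ?thesis using eq[of j i] ij by simp
    qed
  qed
  thus thesis using that[of p] p uv(3) by simp
qed

text \<open>On a path of length \<open>diam\<close>, an inner vertex is farther from one of the two
  ends than from any other inner vertex. So M is the identity on the inner vertices, and one end is
  added by \<open>nonsing_star\<close>. Omitting the other end leaves \<open>diam\<close>
  vertices.\<close>

lemma nonsing_card_diam:
  assumes nu: "\<And>v. \<not> universal v"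
  shows "\<exists>S\<subseteq>V. nonsing S \<and> card S = diam"
proof -
  obtain p where p: "\<And>i. i \<le> diam \<Longrightarrow> p i \<in> V"
    "\<And>i j. i \<le> j \<Longrightarrow> j \<le> diam \<Longrightarrow> d (p i) (p j) = j - i" and inj: "inj_on p {..diam}"
    using diam_path by metis
  have D: "2 \<le> diam" using diam_ge_2[OF nu] .
  let ?I = "{1..<diam}"
  \<comment> \<open>With \<open>1 \<le> i\<close> and \<open>j < diam\<close>, the eccentricities
    are at least \<open>diam - i\<close> and \<open>j\<close>; both exceed the distance
    \<open>j - i\<close>.\<close>
  have zero: "shifted (p i) (p j) = 0" if "1 \<le> i" "i < j" "j < diam" for i j
  proof -
    have "diam - i \<le> ecc (p i)" using d_le_ecc[of "p diam" "p i"] p that sym[of "p diam" "p i"] by auto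
    moreover have "j \<le> ecc (p j)" using d_le_ecc[of "p 0" "p j"] p that by auto
    moreover have "d (p i) (p j) = j - i" using p(2) that by auto
    moreover have "p i \<noteq> p j" using inj that by (auto dest: inj_onD)
    ultimately show ?thesis using that by (auto simp: shifted_def far_def)
  qed
  have "nonsing (insert (p 0) (p ` ?I))"
  proof (rule nonsing_star)
    show "p 0 \<notin> p ` ?I" using inj by (auto dest: inj_onD)
    show "shifted v w = 0" if "v \<in> p ` ?I" "w \<in> p ` ?I" "v \<noteq> w" for v w
    proof -
      obtain i j where ij: "v = p i" "w = p j" "i \<in> ?I" "j \<in> ?I" using \<open>v \<in> _\<close> \<open>w \<in> _\<close> by blast
      hence "i < j \<or> j < i" using that(3) by (metis linorder_neqE_nat)
      thus ?thesis using zero ij shifted_sym[of v w] p(1) by auto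
    qed
    show "shifted (p 0) v = 0 \<or> shifted (p 0) v \<ge> 2" if "v \<in> p ` ?I" for v
    proof -
      have "p 0 \<noteq> v" using that inj by (auto dest: inj_onD)
      moreover have "2 \<le> ecc v" "2 \<le> ecc (p 0)" using that p(1) nu two_le_ecc by auto
      ultimately show ?thesis using shifted_cases[of "p 0" v] by auto
    qed
  qed (use p(1) in auto)
  moreover have "insert (p 0) (p ` ?I) = p ` {..<diam}" using D by (auto simp: image_def)
    (metis One_nat_def Suc_leI atLeastLessThan_iff gr0I)
  moreover have "card (p ` {..<diam}) = diam"
    using card_image[of p "{..<diam}"] inj_on_subset[OF inj, of "{..<diam}"]
    by (simp add: lessThan_subset_iff less_imp_le subset_iff)
  moreover have "p ` {..<diam} \<subseteq> V" using p(1) by auto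
  ultimately show ?thesis by metis
qed

section \<open>Principal submatrices of order four and the path on four vertices\<close>

lemma nonsing_on_fourI:
  assumes "distinct [a, b, c, w]"
    and "\<And>x :: 'a \<Rightarrow> real. (\<And>u. u \<in> {a, b, c, w} \<Longrightarrow>
        f u a * x a + f u b * x b + f u c * x c + f u w * x w = 0) \<Longrightarrow>
        x a = 0 \<and> x b = 0 \<and> x c = 0 \<and> x w = 0"
  shows "nonsing_on f {a, b, c, w}"
  unfolding nonsing_on_def
proof (intro allI impI)
  fix x assume "\<forall>u\<in>{a, b, c, w}. (\<Sum>v\<in>{a, b, c, w}. f u v * x v) = 0"
  moreover have "(\<Sum>v\<in>{a, b, c, w}. f u v * x v)
      = f u a * x a + f u b * x b + f u c * x c + f u w * x w" for u
    using assms(1) by simp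
  ultimately have "\<forall>u\<in>{a, b, c, w}. f u a * x a + f u b * x b + f u c * x c + f u w * x w = 0"
    by metis
  thus "\<forall>v\<in>{a, b, c, w}. x v = 0" using assms(2)[of x] by blast
qed

text \<open>For the listed values of the last column the determinant vanishes in a single case, the
  one that \<open>ne\<close> excludes.\<close>

lemma nonsing_four:
  assumes V: "{a, b, c, w} \<subseteq> V" and dist: "distinct [a, b, c, w]"
    and sh: "shifted a b = 0" "shifted b c = 0" "shifted a c = 2"
    and w: "shifted a w \<in> {0, 2, 3}" "shifted b w \<in> {0, 2}" "shifted c w \<in> {0, 2}"
    and ne: "\<not> (shifted a w = 3 \<and> shifted b w = 2 \<and> shifted c w = 0)"
  shows "nonsing {a, b, c, w}"
proof (rule nonsing_on_fourI[OF dist])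
  fix x :: "'a \<Rightarrow> real"
  assume x: "\<And>u. u \<in> {a, b, c, w} \<Longrightarrow>
      shifted u a * x a + shifted u b * x b + shifted u c * x c + shifted u w * x w = 0"
  define \<alpha> \<beta> \<gamma> where def: "\<alpha> = shifted a w" "\<beta> = shifted b w" "\<gamma> = shifted c w"
  have s: "shifted b a = 0" "shifted c b = 0" "shifted c a = 2"
    "shifted w a = \<alpha>" "shifted w b = \<beta>" "shifted w c = \<gamma>"
    using V sh shifted_sym by (auto simp: def)
  have eqs: "x a + 2 * x c + \<alpha> * x w = 0" "x b + \<beta> * x w = 0"
    "2 * x a + x c + \<gamma> * x w = 0" "\<alpha> * x a + \<beta> * x b + \<gamma> * x c + x w = 0"
    using x[of a] x[of b] x[of c] x[of w] V sh s by (simp_all add: def[symmetric])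
  \<comment> \<open>The negative of the determinant. The identity below eliminates
    \<open>x a\<close>, \<open>x b\<close> and \<open>x c\<close> from the last equation by means of
    the first three.\<close>
  define k where "k = 3 + \<alpha>\<^sup>2 - 4 * \<alpha> * \<gamma> + \<gamma>\<^sup>2 - 3 * \<beta>\<^sup>2"
  have "real_of_int k = 3 + (real_of_int \<alpha>)\<^sup>2 - 4 * real_of_int \<alpha> * real_of_int \<gamma>
      + (real_of_int \<gamma>)\<^sup>2 - 3 * (real_of_int \<beta>)\<^sup>2"
    by (simp add: k_def)
  note k = this
  have "real_of_int k * x w = 3 * (\<alpha> * x a + \<beta> * x b + \<gamma> * x c + x w)
      - \<alpha> * (2 * (2 * x a + x c + \<gamma> * x w) - (x a + 2 * x c + \<alpha> * x w)) - 3 * \<beta> * (x b + \<beta> * x w)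
      - \<gamma> * (2 * (x a + 2 * x c + \<alpha> * x w) - (2 * x a + x c + \<gamma> * x w))"
    unfolding k by (simp add: algebra_simps power2_eq_square)
  hence "real_of_int k * x w = 0" by (simp only: eqs) simp
  moreover have "k \<noteq> 0"
    using w ne by (auto simp: def k_def)
  ultimately have "x w = 0" by simp
  thus "x a = 0 \<and> x b = 0 \<and> x c = 0 \<and> x w = 0" using eqs by simp
qed

text \<open>No four vertices may be nonsingular. Applied to a path of length 3 this fixes its
  submatrix completely. A further vertex \<open>w\<close>, tested with \<open>p 0\<close>,
  \<open>p 1\<close>, \<open>p 2\<close> and with \<open>p 3\<close>, \<open>p 2\<close>,
  \<open>p 1\<close>, would need two different values of \<open>shifted (p 1) w\<close>.\<close>

lemma diam_3_path:
  assumes nu: "\<And>v. \<not> universal v" and D: "diam = 3"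
    and small: "\<And>S. S \<subseteq> V \<Longrightarrow> nonsing S \<Longrightarrow> card S \<le> 3"
  shows "\<exists>p. V = p ` {..3} \<and> inj_on p {..3} \<and> (\<forall>i j. i \<le> j \<longrightarrow> j \<le> 3 \<longrightarrow> d (p i) (p j) = j - i)"
proof -
  obtain p where p: "\<And>i. i \<le> 3 \<Longrightarrow> p i \<in> V"
    "\<And>i j. i \<le> j \<Longrightarrow> j \<le> 3 \<Longrightarrow> d (p i) (p j) = j - i" and inj: "inj_on p {..3}"
    using diam_path unfolding D by metis
  have V: "p 0 \<in> V" "p 1 \<in> V" "p 2 \<in> V" "p 3 \<in> V" using p(1) by auto
  have dist: "distinct [p 0, p 1, p 2, p 3]" using inj by (auto simp: inj_on_eq_iff)
  have ecc: "ecc v = 2 \<or> ecc v = 3" if "v \<in> V" for v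
    using two_le_ecc[OF that nu] ecc_le_diam[OF that] D by linarith
  have ds: "d (p 0) (p 1) = 1" "d (p 0) (p 2) = 2" "d (p 0) (p 3) = 3"
    "d (p 1) (p 2) = 1" "d (p 1) (p 3) = 2" "d (p 2) (p 3) = 1"
    by (simp_all add: p(2))
  have e3: "ecc (p 0) = 3" "ecc (p 3) = 3"
    using d_le_ecc[of "p 3" "p 0"] d_le_ecc[of "p 0" "p 3"] ds V sym[of "p 0" "p 3"]
      ecc[of "p 0"] ecc[of "p 3"] by auto
  have s1: "shifted (p 0) (p 1) = 0" "shifted (p 1) (p 2) = 0" "shifted (p 2) (p 3) = 0"
    "shifted (p 0) (p 3) = 3"
    using ds dist e3 ecc[of "p 1"] ecc[of "p 2"] V by (auto simp: shifted_def far_def)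
  have s2: "shifted (p 0) (p 2) \<in> {0, 2}" "shifted (p 1) (p 3) \<in> {0, 2}"
    using ds dist by (auto simp: shifted_def far_def)
  have both: "shifted (p 0) (p 2) = 2 \<and> shifted (p 1) (p 3) = 2"
  proof (rule ccontr)
    assume ne: "\<not> ?thesis"
    define \<alpha> \<beta> where def: "\<alpha> = shifted (p 0) (p 2)" "\<beta> = shifted (p 1) (p 3)"
    have s: "shifted (p 1) (p 0) = 0" "shifted (p 2) (p 1) = 0" "shifted (p 3) (p 2) = 0"
      "shifted (p 3) (p 0) = 3" "shifted (p 2) (p 0) = \<alpha>" "shifted (p 3) (p 1) = \<beta>"
      using s1 shifted_sym V by (auto simp: def)
    have "nonsing {p 0, p 1, p 2, p 3}"
    proof (rule nonsing_on_fourI[OF dist])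
      fix x :: "'a \<Rightarrow> real"
      assume x: "\<And>u. u \<in> {p 0, p 1, p 2, p 3} \<Longrightarrow> shifted u (p 0) * x (p 0)
          + shifted u (p 1) * x (p 1) + shifted u (p 2) * x (p 2) + shifted u (p 3) * x (p 3) = 0"
      have "x (p 0) + \<alpha> * x (p 2) + 3 * x (p 3) = 0" "x (p 1) + \<beta> * x (p 3) = 0"
        "\<alpha> * x (p 0) + x (p 2) = 0" "3 * x (p 0) + \<beta> * x (p 1) + x (p 3) = 0"
        using x[of "p 0"] x[of "p 1"] x[of "p 2"] x[of "p 3"] V s1 s
        by (simp_all add: def[symmetric] del: One_nat_def)
      moreover have "\<alpha> = 0 \<and> \<beta> = 0 \<or> \<alpha> = 2 \<and> \<beta> = 0 \<or> \<alpha> = 0 \<and> \<beta> = 2"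
        using s2 ne by (auto simp: def)
      ultimately show "x (p 0) = 0 \<and> x (p 1) = 0 \<and> x (p 2) = 0 \<and> x (p 3) = 0"
        by (elim disjE conjE) simp_all
    qed
    from small[OF _ this] show False using V dist by simp
  qed
  \<comment> \<open>The nonzero entry at distance 2 from an end, whose eccentricity is 3, forces
    eccentricity 2 at the inner vertex.\<close>
  have e2: "ecc (p 1) = 2" "ecc (p 2) = 2"
    using both dist e3 by (auto simp: shifted_def far_def min_def split: if_splits)
  have "w \<in> p ` {..3}" if w: "w \<in> V" for w
  proof (rule ccontr)
    assume "w \<notin> p ` {..3}"
    hence ne: "w \<noteq> p 0" "w \<noteq> p 1" "w \<noteq> p 2" "w \<noteq> p 3" by auto
    have in03: "shifted (p i) w \<in> {0, 2, 3}" if "i = 0 \<or> i = 3" for i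
      using shifted_cases[of "p i" w] ne e3 ecc[OF w] that by auto
    have in12: "shifted (p i) w \<in> {0, 2}" if "i = 1 \<or> i = 2" for i
      using shifted_cases[of "p i" w] ne e2 ecc[OF w] that by auto
    have sw: "shifted (p 3) (p 2) = 0" "shifted (p 2) (p 1) = 0" "shifted (p 3) (p 1) = 2"
      using s1 both shifted_sym V by auto
    have "\<not> nonsing {p 0, p 1, p 2, w}" "\<not> nonsing {p 3, p 2, p 1, w}"
      using small[of "{p 0, p 1, p 2, w}"] small[of "{p 3, p 2, p 1, w}"] V w ne dist by auto
    moreover have "nonsing {p 0, p 1, p 2, w} \<or> shifted (p 1) w = 2"
      using nonsing_four[of "p 0" "p 1" "p 2" w] V w ne dist s1 both in03 in12 by auto
    moreover have "nonsing {p 3, p 2, p 1, w} \<or> shifted (p 1) w = 0"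
      \<comment> \<open>Read from the end \<open>p 3\<close>, the exceptional column of
        \<open>nonsing_four\<close> has its 0 at \<open>p 1\<close>; read from \<open>p 0\<close>,
        it has its 2 there.\<close>
      using nonsing_four[of "p 3" "p 2" "p 1" w] V w ne dist sw in03 in12 by auto
    ultimately show False by simp
  qed
  hence "V = p ` {..3}" using p(1) by auto
  thus ?thesis using inj p(2) by blast
qed

text \<open>The number \<open>r\<close> is any bound on nonsingular sets; it will be the rank. It
  bounds the diameter and each class of vertices whose eccentricities share a divisor, and a few
  such classes cover the graph.\<close>

lemma card_le_if_no_universal:
  assumes nu: "\<And>v. \<not> universal v"
    and small: "\<And>S. S \<subseteq> V \<Longrightarrow> nonsing S \<Longrightarrow> card S \<le> r"
  shows "3 \<le> r"
    and "r = 3 \<Longrightarrow> card V \<ge> 4 \<Longrightarrow>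
      \<exists>p. V = p ` {..3} \<and> inj_on p {..3} \<and> (\<forall>i j. i \<le> j \<longrightarrow> j \<le> 3 \<longrightarrow> d (p i) (p j) = j - i)"
    and "r \<le> 4 \<Longrightarrow> card V \<le> 8"
    and "r \<le> 5 \<Longrightarrow> card V \<le> 15"
proof -
  have D2: "2 \<le> diam" using diam_ge_2[OF nu] .
  obtain S where "S \<subseteq> V" "nonsing S" "card S = diam" using nonsing_card_diam[OF nu] by metis
  hence Dr: "diam \<le> r" using small by metis
  have layer: "card {v \<in> V. c dvd ecc v} \<le> r" if "c > 1" for c
    by (rule small, blast, rule nonsing_on_if_dvd_ecc[OF _ that]) auto
  have ecc: "2 \<le> ecc v" "diam \<le> 2 * ecc v" "ecc v \<le> diam" if "v \<in> V" for v
    using two_le_ecc[OF that nu] diam_le_double_ecc[OF that] ecc_le_diam[OF that] by blast+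
  have D2_card: "card V \<le> r" if "diam = 2"
  proof -
    have "ecc v = 2" if "v \<in> V" for v using ecc[OF that] \<open>diam = 2\<close> by linarith
    hence "{v \<in> V. 2 dvd ecc v} = V" by auto
    thus ?thesis using layer[of 2] by simp
  qed
  \<comment> \<open>A path of length \<open>diam\<close> has \<open>diam + 1\<close> vertices. If
    \<open>diam = 2\<close>, these are three vertices in a graph of order at most \<open>r\<close>;
    otherwise 3 \<le> \<open>diam\<close> \<le> \<open>r\<close>.\<close>
  obtain p where p: "\<And>i. i \<le> diam \<Longrightarrow> p i \<in> V" and inj: "inj_on p {..diam}" using diam_path by metis
  have "card (p ` {..diam}) \<le> card V" using p finite by (intro card_mono) auto
  hence "diam + 1 \<le> card V" using card_image[OF inj] by simp
  thus "3 \<le> r" using D2 Dr D2_card by linarith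
  show "\<exists>p. V = p ` {..3} \<and> inj_on p {..3} \<and> (\<forall>i j. i \<le> j \<longrightarrow> j \<le> 3 \<longrightarrow> d (p i) (p j) = j - i)"
    if "r = 3" "card V \<ge> 4"
  proof -
    have "diam = 3" using D2 Dr D2_card that by (cases "diam = 2") linarith+
    thus ?thesis using small that(1) by (intro diam_3_path[OF nu]) auto
  qed
  have cover: "card V \<le> card A + card B" if "V \<subseteq> A \<union> B" "A \<subseteq> V" "B \<subseteq> V" for A B
    using card_mono[of "A \<union> B" V] card_Un_le[of A B] that finite finite_subset[of _ V] by fastforce
  have D34: "card V \<le> 2 * r" if "diam = 3 \<or> diam = 4"
  proof -
    have "2 dvd ecc v \<or> 3 dvd ecc v" if "v \<in> V" for v
    proof -
      have "ecc v = 2 \<or> ecc v = 3 \<or> ecc v = 4" using ecc[OF that] \<open>diam = 3 \<or> diam = 4\<close> by auto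
      thus ?thesis by auto
    qed
    hence "card V \<le> card {v \<in> V. 2 dvd ecc v} + card {v \<in> V. 3 dvd ecc v}"
      by (intro cover) auto
    thus ?thesis using layer[of 2] layer[of 3] by linarith
  qed
  \<comment> \<open>Eccentricity 2 cannot occur at diameter 5 by
    \<open>diam \<le> 2 * ecc v\<close>, so the values 3, 4 and 5 remain.\<close>
  have D5: "card V \<le> 3 * r" if "diam = 5"
  proof -
    let ?E = "\<lambda>c. {v \<in> V. c dvd ecc v}"
    have "ecc v = 3 \<or> ecc v = 4 \<or> ecc v = 5" if "v \<in> V" for v
      using ecc[OF that] \<open>diam = 5\<close> by auto
    hence "3 dvd ecc v \<or> 4 dvd ecc v \<or> 5 dvd ecc v" if "v \<in> V" for v
      using that by fastforce
    hence "card V \<le> card (?E 3 \<union> ?E 4) + card (?E 5)"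
      by (intro cover) auto
    moreover have "card (?E 3 \<union> ?E 4) \<le> card (?E 3) + card (?E 4)" by (rule card_Un_le)
    ultimately show ?thesis using layer[of 3] layer[of 4] layer[of 5] by linarith
  qed
  show "card V \<le> 8" if r: "r \<le> 4"
  proof -
    consider "diam = 2" | "diam = 3 \<or> diam = 4" using D2 Dr r by linarith
    thus ?thesis using D2_card D34 that by cases auto
  qed
  show "card V \<le> 15" if r: "r \<le> 5"
  proof -
    consider "diam = 2" | "diam = 3 \<or> diam = 4" | "diam = 5" using D2 Dr r by linarith
    thus ?thesis using D2_card D34 D5 that by cases auto
  qed
qed

end

section \<open>Graphs on few vertices\<close>

text \<open>A code for the graph induced on a list of vertices: the strict upper triangle of its
  adjacency matrix. The empty last row is kept, so the number of rows is the number of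
  vertices.\<close>

fun adj_rows :: "('a \<Rightarrow> 'a \<Rightarrow> bool) \<Rightarrow> 'a list \<Rightarrow> bool list list" where
  "adj_rows E [] = []"
| "adj_rows E (v # vs) = map (E v) vs # adj_rows E vs"

text \<open>For symmetric \<open>E\<close>, the graph induced on \<open>W\<close> is isomorphic to
  the one coded by \<open>R\<close>.\<close>

definition realizes :: "('a \<Rightarrow> 'a \<Rightarrow> bool) \<Rightarrow> 'a set \<Rightarrow> bool list list \<Rightarrow> bool" where
  "realizes E W R \<longleftrightarrow> (\<exists>ws. distinct ws \<and> set ws = W \<and> adj_rows E ws = R)"

text \<open>Decodes an edge in either direction. Row \<open>i\<close> starts at column
  \<open>i + 1\<close>, which explains the offset; the value for \<open>i = j\<close> is
  meaningless.\<close>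

definition row_edge :: "bool list list \<Rightarrow> nat \<Rightarrow> nat \<Rightarrow> bool" where
  "row_edge R i j = (if i < j then R ! i ! (j - i - 1) else R ! j ! (i - j - 1))"

fun all_rows :: "nat \<Rightarrow> bool list list list" where
  "all_rows 0 = [[]]"
| "all_rows (Suc n) = [r # R. r \<leftarrow> List.n_lists n [True, False], R \<leftarrow> all_rows n]"

text \<open>Together with \<open>orders\<close> an executable enumeration of permutations, meant for
  evaluation by \<open>code_simp\<close>.\<close>

fun insertions :: "'a \<Rightarrow> 'a list \<Rightarrow> 'a list list" where
  "insertions x [] = [[x]]"
| "insertions x (y # ys) = (x # y # ys) # map ((#) y) (insertions x ys)"

fun orders :: "'a list \<Rightarrow> 'a list list" where
  "orders [] = [[]]"
| "orders (x # xs) = concat (map (insertions x) (orders xs))"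

definition rows_universal :: "nat \<Rightarrow> bool list list \<Rightarrow> bool" where
  "rows_universal n R = list_ex (\<lambda>i. list_all (\<lambda>j. i = j \<or> row_edge R i j) [0..<n]) [0..<n]"

text \<open>Some renumbering of the graph coded by \<open>R\<close> has its code in
  \<open>L\<close>.\<close>

definition rows_classified :: "nat \<Rightarrow> bool list list list \<Rightarrow> bool list list \<Rightarrow> bool" where
  "rows_classified n L R = list_ex (\<lambda>p. List.member L (adj_rows (row_edge R) p)) (orders [0..<n])"

lemma mset_insertions: "ys \<in> set (insertions x xs) \<Longrightarrow> mset ys = add_mset x (mset xs)"
  by (induction x xs arbitrary: ys rule: insertions.induct) auto

lemma mset_orders: "p \<in> set (orders xs) \<Longrightarrow> mset p = mset xs"
  by (induction xs arbitrary: p) (auto dest!: mset_insertions)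

lemma length_adj_rows [simp]: "length (adj_rows E ws) = length ws"
  by (induction ws) auto

lemma adj_rows_map: "adj_rows E (map f ws) = adj_rows (\<lambda>x y. E (f x) (f y)) ws"
  by (induction ws) auto

lemma adj_rows_cong:
  assumes "distinct ws" "\<And>x y. x \<in> set ws \<Longrightarrow> y \<in> set ws \<Longrightarrow> x \<noteq> y \<Longrightarrow> E x y = F x y"
  shows "adj_rows E ws = adj_rows F ws"
  using assms by (induction ws) auto

lemma adj_rows_nth: "i < j \<Longrightarrow> j < length ws \<Longrightarrow> adj_rows E ws ! i ! (j - i - 1) = E (ws ! i) (ws ! j)"
proof (induction ws arbitrary: i j)
  case (Cons v ws)
  then obtain k where "j = Suc k" by (cases j) auto
  thus ?case using Cons by (cases i) auto
qed simp

lemma row_edge_adj_rows: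
  assumes "\<And>x y. x \<in> set ws \<Longrightarrow> y \<in> set ws \<Longrightarrow> E x y = E y x"
    and "i < length ws" "j < length ws" "i \<noteq> j"
  shows "row_edge (adj_rows E ws) i j = E (ws ! i) (ws ! j)"
  using assms adj_rows_nth[of i j ws E] adj_rows_nth[of j i ws E] by (auto simp: row_edge_def)

lemma adj_rows_in_all_rows: "length ws = n \<Longrightarrow> adj_rows E ws \<in> set (all_rows n)"
proof (induction ws arbitrary: n)
  case (Cons v ws)
  have "map (E v) ws \<in> set (List.n_lists (length ws) [True, False])" by (auto simp: set_n_lists)
  thus ?case using Cons by (auto intro!: bexI[of _ "map (E v) ws"])
qed simp

lemma rows_universalD:
  assumes sym: "\<And>x y. x \<in> set ws \<Longrightarrow> y \<in> set ws \<Longrightarrow> E x y = E y x"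
    and "rows_universal (length ws) (adj_rows E ws)"
  shows "\<exists>u\<in>set ws. \<forall>v\<in>set ws. v \<noteq> u \<longrightarrow> E u v"
proof -
  obtain i where i: "i < length ws"
    "\<And>j. j < length ws \<Longrightarrow> i = j \<or> row_edge (adj_rows E ws) i j"
    using assms(2) by (auto simp: rows_universal_def list_ex_iff list_all_iff)
  have "E (ws ! i) v" if "v \<in> set ws" "v \<noteq> ws ! i" for v
  proof -
    obtain j where j: "j < length ws" "v = ws ! j" using \<open>v \<in> set ws\<close> by (metis in_set_conv_nth)
    hence "i \<noteq> j" using that(2) by blast
    moreover from this have "row_edge (adj_rows E ws) i j" using i(2)[OF j(1)] by blast
    ultimately show ?thesis using row_edge_adj_rows[of ws E i j] sym i(1) j by simp
  qed
  thus ?thesis using i(1) by (intro bexI[of _ "ws ! i"]) auto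
qed

text \<open>A permutation \<open>p\<close> of positions that brings the code into \<open>L\<close>
  turns into the reordering \<open>map ((!) ws) p\<close> of the vertices, which has the same
  code.\<close>

lemma rows_classifiedD:
  assumes sym: "\<And>x y. x \<in> set ws \<Longrightarrow> y \<in> set ws \<Longrightarrow> E x y = E y x"
    and ws: "distinct ws" and cl: "rows_classified (length ws) L (adj_rows E ws)"
  shows "\<exists>R\<in>set L. realizes E (set ws) R"
proof -
  let ?n = "length ws"
  obtain p where p: "mset p = mset [0..<?n]" and R: "adj_rows (row_edge (adj_rows E ws)) p \<in> set L"
    using cl mset_orders by (fastforce simp: rows_classified_def list_ex_iff List.member_iff)
  have setp: "set p = {0..<?n}" and dp: "distinct p"
    using mset_eq_setD[OF p] mset_eq_imp_distinct_iff[OF p] by auto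
  have "adj_rows E (map ((!) ws) p) = adj_rows (row_edge (adj_rows E ws)) p"
    unfolding adj_rows_map
    by (rule adj_rows_cong[OF dp]) (use row_edge_adj_rows[of ws E] sym setp in simp)
  moreover have "distinct (map ((!) ws) p)"
    using dp ws setp by (auto simp: distinct_map inj_on_def nth_eq_iff_index_eq)
  moreover have "set (map ((!) ws) p) = set ws"
    by (simp add: setp nth_image)
  ultimately show ?thesis using R unfolding realizes_def by metis
qed

section \<open>Codes of small graphs and exhaustive checks\<close>

text \<open>The graphs of order four without a universal vertex, in the order of
  \<open>G1_family\<close>: the second operands of its joins.\<close>

definition rows4 :: "bool list list list" where
  "rows4 =
   [[[False, False, False], [False, False], [False], []],
    [[False, False, False], [False, False], [True], []],
    [[True, False, False], [True, False], [False], []],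
    [[True, False, False], [False, False], [True], []],
    [[True, False, False], [True, False], [True], []],
    [[True, True, False], [True, False], [False], []],
    [[True, False, True], [True, False], [True], []]]"

text \<open>The cycle C5, the union of K1 and P4, and the bull, which form the singular case of
  order five.\<close>

definition rows5 :: "bool list list list" where
  "rows5 =
   [[[True, False, False, True], [True, False, False], [True, False], [True], []],
    [[False, False, False, False], [True, False, False], [True, False], [True], []],
    [[True, True, True, False], [True, False, True], [False, False], [False], []]]"

definition path4_rows :: "bool list list" where
  "path4_rows = [[True, False, False], [True, False], [True], []]"

text \<open>The ten graphs of order four other than P4. P4 is set apart because only it leads to a
  singular Seidel matrix of order five.\<close>

definition nonpath4_rows :: "bool list list list" where
  "nonpath4_rows =
   [[[False, False, False], [False, False], [False], []],
    [[False, False, False], [False, False], [True], []],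
    [[True, False, False], [True, False], [False], []],
    [[True, False, False], [False, False], [True], []],
    [[True, True, False], [True, False], [False], []],
    [[True, False, True], [True, False], [True], []],
    [[True, True, True], [False, False], [False], []],
    [[True, True, True], [True, False], [False], []],
    [[True, True, True], [True, True], [False], []],
    [[True, True, True], [True, True], [True], []]]"

text \<open>The graph obtained from \<open>K\<^sub>1 \<union> P\<^sub>4\<close> by Seidel switching that joins the isolated vertex to the
  path vertices selected by \<open>p\<close>, \<open>q\<close>, \<open>r\<close>, \<open>s\<close>.\<close>

definition switch_path4 :: "bool \<Rightarrow> bool \<Rightarrow> bool \<Rightarrow> bool \<Rightarrow> bool list list" where
  "switch_path4 p q r s = [[p, q, r, s], [p = q, p \<noteq> r, p \<noteq> s], [q = r, q \<noteq> s], [r = s], []]"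

text \<open>This statement and the next two are finite checks, over the 8 codes of order three and
  the 64 of order four.\<close>

lemma rows3_classification:
  "list_all (\<lambda>R. rows_universal 3 R
      \<or> rows_classified 3 [[[True, False], [False], []], [[False, False], [False], []]] R) (all_rows 3)"
  by code_simp

lemma rows4_classification:
  "list_all (\<lambda>R. rows_universal 4 R \<or> rows_classified 4 rows4 R) (all_rows 4)"
  by code_simp

lemma all_rows4_classification:
  "list_all (rows_classified 4 (path4_rows # nonpath4_rows)) (all_rows 4)"
  by code_simp

text \<open>Runs through the 16 ways of joining the isolated vertex; only the switched graphs
  without a universal vertex need a code from \<open>rows5\<close>.\<close>

lemma switch_path4_classification:
  "list_all (\<lambda>(p, q, r, s). rows_universal 5 (switch_path4 p q r s)
      \<or> rows_classified 5 rows5 (switch_path4 p q r s))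
    (List.product [True, False] (List.product [True, False] (List.product [True, False] [True, False])))"
  by code_simp

section \<open>Kernels of small Seidel matrices\<close>

definition edge_sign :: "bool \<Rightarrow> int" where
  "edge_sign b = (if b then - 1 else 1)"

text \<open>With adjacency matrix A this is the usual Seidel matrix J - I - 2A.\<close>

definition seidel :: "('a \<Rightarrow> 'a \<Rightarrow> bool) \<Rightarrow> 'a \<Rightarrow> 'a \<Rightarrow> real" where
  "seidel E u v = (if u = v then 0 else of_int (edge_sign (E u v)))"

text \<open>The determinant is twice the product of the three signs, hence nonzero.\<close>

lemma seidel_three_kernel:
  fixes a b c :: real
  assumes "edge_sign p * b + edge_sign q * c = 0" "edge_sign p * a + edge_sign r * c = 0"
    "edge_sign q * a + edge_sign r * b = 0"
  shows "a = 0 \<and> b = 0 \<and> c = 0"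
  using assms unfolding edge_sign_def
  by (cases p; cases q; cases r; simp only: if_True if_False of_int_1 of_int_minus mult_1_left
      mult_minus_left; intro conjI; linarith)

text \<open>Modulo 2 the matrix is J - I of order four, whose determinant is -3, so it is never
  singular. Restricting to one code per isomorphism type leaves eleven linear systems to
  solve.\<close>

lemma seidel_four_kernel:
  fixes a b c d :: real
  assumes "edge_sign p * b + edge_sign q * c + edge_sign r * d = 0"
    "edge_sign p * a + edge_sign s * c + edge_sign t * d = 0"
    "edge_sign q * a + edge_sign s * b + edge_sign u * d = 0"
    "edge_sign r * a + edge_sign t * b + edge_sign u * c = 0"
    and "[[p, q, r], [s, t], [u], []] \<in> set (path4_rows # nonpath4_rows)"
  shows "a = 0 \<and> b = 0 \<and> c = 0 \<and> d = 0"
  using assms(5,1-4) unfolding edge_sign_def path4_rows_def nonpath4_rows_def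
  by (simp only: list.set insert_iff empty_iff list.inject simp_thms;
      elim disjE conjE; simp only: simp_thms if_True if_False of_int_1
      of_int_minus mult_1_left mult_minus_left; intro conjI; linarith)

text \<open>The variable \<open>a\<close> belongs to an isolated vertex, whose signs are all 1; the
  other four vertices carry any graph except P4.\<close>

lemma seidel_five_kernel:
  fixes a b c d e :: real
  assumes "b + c + d + e = 0"
    "a + edge_sign p * c + edge_sign q * d + edge_sign r * e = 0"
    "a + edge_sign p * b + edge_sign s * d + edge_sign t * e = 0"
    "a + edge_sign q * b + edge_sign s * c + edge_sign u * e = 0"
    "a + edge_sign r * b + edge_sign t * c + edge_sign u * d = 0"
    and "[[p, q, r], [s, t], [u], []] \<in> set nonpath4_rows"
  shows "a = 0 \<and> b = 0 \<and> c = 0 \<and> d = 0 \<and> e = 0"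
  using assms(6,1-5) unfolding edge_sign_def nonpath4_rows_def
  by (simp only: list.set insert_iff empty_iff list.inject simp_thms;
      elim disjE conjE; simp only: simp_thms if_True if_False of_int_1
      of_int_minus mult_1_left mult_minus_left; intro conjI; linarith)

lemma order_four:
  assumes sym: "\<And>x y. x \<in> W \<Longrightarrow> y \<in> W \<Longrightarrow> E x y = E y x" and card: "card W = 4"
  obtains a b c d where "distinct [a, b, c, d]" "W = {a, b, c, d}"
    "adj_rows E [a, b, c, d] \<in> set (path4_rows # nonpath4_rows)"
proof -
  have "finite W" using card card.infinite by fastforce
  then obtain ws where ws: "set ws = W" "distinct ws" using finite_distinct_list by blast
  hence len: "length ws = 4" using card distinct_card by fastforce
  have "rows_classified (length ws) (path4_rows # nonpath4_rows) (adj_rows E ws)"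
    using all_rows4_classification adj_rows_in_all_rows[OF len, of E] by (simp add: list_all_iff len)
  hence "\<exists>R\<in>set (path4_rows # nonpath4_rows). realizes E (set ws) R"
    by (intro rows_classifiedD) (use sym ws in auto)
  then obtain vs where vs: "distinct vs" "set vs = W" "adj_rows E vs \<in> set (path4_rows # nonpath4_rows)"
    unfolding realizes_def ws(1) by blast
  hence "length vs = 4" using card distinct_card by fastforce
  then obtain a b c d where "vs = [a, b, c, d]"
    by (auto simp: length_Suc_conv numeral_eq_Suc)
  thus thesis using vs that[of a b c d] by simp
qed

text \<open>Order one is excluded: there the Seidel matrix is zero. Order four uses a numbering that
  produces one of the eleven codes.\<close>

lemma nonsing_on_seidel_small:
  assumes sym: "\<And>x y. x \<in> W \<Longrightarrow> y \<in> W \<Longrightarrow> E x y = E y x"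
    and card: "card W = 2 \<or> card W = 3 \<or> card W = 4"
  shows "nonsing_on (seidel E) W"
  unfolding nonsing_on_def
proof (intro allI impI)
  fix x assume x: "\<forall>u\<in>W. (\<Sum>v\<in>W. seidel E u v * x v) = 0"
  have "finite W" using card card.infinite by fastforce
  then obtain ws where ws: "set ws = W" "distinct ws" using finite_distinct_list by blast
  hence len: "length ws = card W" using distinct_card by fastforce
  from card show "\<forall>v\<in>W. x v = 0"
  proof (elim disjE)
    assume "card W = 2"
    then obtain a b where ab: "ws = [a, b]"
      using len by (auto simp: length_Suc_conv numeral_2_eq_2)
    hence W: "W = {a, b}" "a \<noteq> b" using ws by auto
    have "seidel E a b * x b = 0" "seidel E b a * x a = 0"
      using bspec[OF x, of a] bspec[OF x, of b] W by (auto simp: seidel_def)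
    thus ?thesis using W by (auto simp: seidel_def edge_sign_def split: if_splits)
  next
    assume "card W = 3"
    then obtain a b c where abc: "ws = [a, b, c]"
      using len by (auto simp: length_Suc_conv numeral_3_eq_3)
    hence W: "W = {a, b, c}" "distinct [a, b, c]" using ws by auto
    have row: "seidel E u a * x a + (seidel E u b * x b + seidel E u c * x c) = 0"
      if "u \<in> {a, b, c}" for u
      using bspec[OF x, of u] W that by simp
    have s: "E b a = E a b" "E c a = E a c" "E c b = E b c" using sym W by auto
    have ne: "b \<noteq> a" "c \<noteq> a" "c \<noteq> b" using W by auto
    have "x a = 0 \<and> x b = 0 \<and> x c = 0"
      by (rule seidel_three_kernel[of "E a b" _ "E a c" _ _ "E b c"])
        (use row[of a] row[of b] row[of c] W(2) s ne in \<open>simp_all add: seidel_def add.assoc\<close>)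
    thus ?thesis using W by simp
  next
    assume "card W = 4"
    then obtain a b c e where W: "distinct [a, b, c, e]" "W = {a, b, c, e}"
      and rows: "adj_rows E [a, b, c, e] \<in> set (path4_rows # nonpath4_rows)"
      using order_four[of W E] sym by blast
    have row: "seidel E u a * x a + (seidel E u b * x b + (seidel E u c * x c + seidel E u e * x e)) = 0"
      if "u \<in> {a, b, c, e}" for u
      using bspec[OF x, of u] W that by simp
    have s: "E b a = E a b" "E c a = E a c" "E c b = E b c" "E e a = E a e" "E e b = E b e" "E e c = E c e"
      using sym W by auto
    have ne: "b \<noteq> a" "c \<noteq> a" "e \<noteq> a" "c \<noteq> b" "e \<noteq> b" "e \<noteq> c" using W by auto
    have "x a = 0 \<and> x b = 0 \<and> x c = 0 \<and> x e = 0"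
      by (rule seidel_four_kernel[of "E a b" _ "E a c" _ "E a e" _ _ "E b c" "E b e" "E c e"])
        (use rows row[of a] row[of b] row[of c] row[of e] W(1) s ne in \<open>simp_all add: seidel_def add.assoc\<close>)
    thus ?thesis using W by simp
  qed
qed

text \<open>Scaling row and column \<open>v\<close> of the Seidel matrix by the sign of the edge \<open>av\<close> isolates \<open>a\<close>
  (Seidel switching).\<close>

lemma nonsing_on_seidel_five:
  assumes sym: "\<And>x y. x \<in> {a, b, c, d, e} \<Longrightarrow> y \<in> {a, b, c, d, e} \<Longrightarrow> E x y = E y x"
    and dist: "distinct [a, b, c, d, e]"
    and T: "\<And>x y. T x y = (E a x \<noteq> (E a y \<noteq> E x y))"
    and np: "adj_rows T [b, c, d, e] \<in> set nonpath4_rows"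
  shows "nonsing_on (seidel E) {a, b, c, d, e}"
proof (rule ccontr)
  assume sing: "\<not> ?thesis"
  obtain x where x: "\<forall>u\<in>{a, b, c, d, e}. (\<Sum>v\<in>{a, b, c, d, e}. seidel E u v * x v) = 0"
    and xnz: "\<exists>v\<in>{a, b, c, d, e}. x v \<noteq> 0"
    using sing unfolding nonsing_on_def by blast
  have row: "seidel E u a * x a + (seidel E u b * x b + (seidel E u c * x c
      + (seidel E u d * x d + seidel E u e * x e))) = 0"
    if "u \<in> {a, b, c, d, e}" for u
    using bspec[OF x that] dist by simp
  define s :: "'a \<Rightarrow> real" where "s = (\<lambda>v. edge_sign (E a v))"
  define f :: "'a \<Rightarrow> 'a \<Rightarrow> real" where "f = (\<lambda>u v. edge_sign (E u v))"
  have s2: "s v * s v = 1" "s v * (s v * r) = r" for v r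
    by (simp_all add: s_def edge_sign_def)
  \<comment> \<open>\<open>edge_sign\<close> turns exclusive or into a product, and the two factors
    \<open>s v\<close> cancel.\<close>
  have T': "real_of_int (edge_sign (T u v)) * (s v * r) = s u * (f u v * r)" for u v r
    by (simp add: T s_def f_def edge_sign_def)
  have sy: "E b a = E a b" "E c a = E a c" "E d a = E a d" "E e a = E a e" "E c b = E b c"
    "E d b = E b d" "E e b = E b e" "E d c = E c d" "E e c = E c e" "E e d = E d e"
    using sym by auto
  have ne: "b \<noteq> a" "c \<noteq> a" "d \<noteq> a" "e \<noteq> a" "c \<noteq> b" "d \<noteq> b" "e \<noteq> b" "d \<noteq> c" "e \<noteq> c" "e \<noteq> d"
    using dist by auto
  have eq: "s b * x b + (s c * x c + (s d * x d + s e * x e)) = 0"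
    "s b * x a + (f b c * x c + (f b d * x d + f b e * x e)) = 0"
    "s c * x a + (f b c * x b + (f c d * x d + f c e * x e)) = 0"
    "s d * x a + (f b d * x b + (f c d * x c + f d e * x e)) = 0"
    "s e * x a + (f b e * x b + (f c e * x c + f d e * x d)) = 0"
    using row[of a] row[of b] row[of c] row[of d] row[of e] dist sy ne
    by (simp_all add: seidel_def s_def f_def)
  have scale: "s v * (s v * x a + r) = x a + s v * r" for v r
    by (simp add: algebra_simps s2)
  \<comment> \<open>The switched matrix acts on the unknowns \<open>s v * x v\<close>; its row
    \<open>v\<close> is the original row multiplied by \<open>s v\<close>. Row \<open>a\<close>
    already has this form.\<close>
  have "x a = 0 \<and> s b * x b = 0 \<and> s c * x c = 0 \<and> s d * x d = 0 \<and> s e * x e = 0"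
  proof (rule seidel_five_kernel)
    show "[[T b c, T b d, T b e], [T c d, T c e], [T d e], []] \<in> set nonpath4_rows"
      using np by simp
    have Tsym: "T c b = T b c" "T d b = T b d" "T e b = T b e" "T d c = T c d" "T e c = T c e" "T e d = T d e"
      using sy by (auto simp: T)
    have fsym: "f c b = f b c" "f d b = f b d" "f e b = f b e" "f d c = f c d" "f e c = f c e" "f e d = f d e"
      using sy by (auto simp: f_def)
    show "s b * x b + s c * x c + s d * x d + s e * x e = 0" using eq(1) by simp
    show "x a + edge_sign (T b c) * (s c * x c) + edge_sign (T b d) * (s d * x d)
        + edge_sign (T b e) * (s e * x e) = 0"
      using arg_cong[OF eq(2), of "\<lambda>r. s b * r"] unfolding scale T' by (simp add: algebra_simps)
    show "x a + edge_sign (T b c) * (s b * x b) + edge_sign (T c d) * (s d * x d)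
        + edge_sign (T c e) * (s e * x e) = 0"
      using arg_cong[OF eq(3), of "\<lambda>r. s c * r"] unfolding Tsym(1)[symmetric] scale T' fsym
      by (simp add: algebra_simps)
    show "x a + edge_sign (T b d) * (s b * x b) + edge_sign (T c d) * (s c * x c)
        + edge_sign (T d e) * (s e * x e) = 0"
      using arg_cong[OF eq(4), of "\<lambda>r. s d * r"] unfolding Tsym(2,4)[symmetric] scale T' fsym
      by (simp add: algebra_simps)
    show "x a + edge_sign (T b e) * (s b * x b) + edge_sign (T c e) * (s c * x c)
        + edge_sign (T d e) * (s d * x d) = 0"
      using arg_cong[OF eq(5), of "\<lambda>r. s e * r"] unfolding Tsym(3,5,6)[symmetric] scale T' fsym
      by (simp add: algebra_simps)
  qed
  moreover have "s v \<noteq> 0" for v using s2(1)[of v] by auto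
  ultimately show False using xnz by auto
qed

section \<open>Recognising small graphs by their codes\<close>

lemma realizes_3:
  assumes sym: "\<And>x y. x \<in> W \<Longrightarrow> y \<in> W \<Longrightarrow> E x y = E y x"
    and card: "card W = 3" and nu: "\<And>u. u \<in> W \<Longrightarrow> \<exists>v\<in>W. v \<noteq> u \<and> \<not> E u v"
  shows "\<exists>R\<in>{[[True, False], [False], []], [[False, False], [False], []]}. realizes E W R"
proof -
  have "finite W" using card card.infinite by fastforce
  then obtain ws where ws: "set ws = W" "distinct ws" using finite_distinct_list by blast
  hence len: "length ws = 3" using card distinct_card by fastforce
  have s: "\<And>x y. x \<in> set ws \<Longrightarrow> y \<in> set ws \<Longrightarrow> E x y = E y x" using sym ws by blast
  have "\<not> rows_universal (length ws) (adj_rows E ws)"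
    using rows_universalD[of ws E] s nu ws by blast
  hence "rows_classified (length ws) [[[True, False], [False], []], [[False, False], [False], []]] (adj_rows E ws)"
    using rows3_classification adj_rows_in_all_rows[OF len, of E] by (auto simp: list_all_iff len)
  from rows_classifiedD[OF s ws(2) this] show ?thesis using ws by simp
qed

lemma realizes_4:
  assumes sym: "\<And>x y. x \<in> W \<Longrightarrow> y \<in> W \<Longrightarrow> E x y = E y x"
    and card: "card W = 4" and nu: "\<And>u. u \<in> W \<Longrightarrow> \<exists>v\<in>W. v \<noteq> u \<and> \<not> E u v"
  shows "\<exists>R\<in>set rows4. realizes E W R"
proof -
  have "finite W" using card card.infinite by fastforce
  then obtain ws where ws: "set ws = W" "distinct ws" using finite_distinct_list by blast
  hence len: "length ws = 4" using card distinct_card by fastforce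
  have s: "\<And>x y. x \<in> set ws \<Longrightarrow> y \<in> set ws \<Longrightarrow> E x y = E y x" using sym ws by blast
  have "\<not> rows_universal (length ws) (adj_rows E ws)"
    using rows_universalD[of ws E] s nu ws by blast
  hence "rows_classified (length ws) rows4 (adj_rows E ws)"
    using rows4_classification adj_rows_in_all_rows[OF len, of E] by (auto simp: list_all_iff len)
  from rows_classifiedD[OF s ws(2) this] show ?thesis using ws by simp
qed

text \<open>Switching isolates an arbitrary vertex \<open>a\<close>. As the Seidel matrix is
  singular, the rest must become P4, so the graph is a switching of the union of K1 and P4, and
  these have been enumerated.\<close>

lemma realizes_5:
  assumes sym: "\<And>x y. x \<in> W \<Longrightarrow> y \<in> W \<Longrightarrow> E x y = E y x"
    and card: "card W = 5" and nu: "\<And>u. u \<in> W \<Longrightarrow> \<exists>v\<in>W. v \<noteq> u \<and> \<not> E u v"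
    and sing: "\<not> nonsing_on (seidel E) W"
  shows "\<exists>R\<in>set rows5. realizes E W R"
proof -
  have "finite W" "W \<noteq> {}" using card card.infinite by fastforce+
  then obtain a where a: "a \<in> W" by blast
  define T where "T = (\<lambda>x y. E a x \<noteq> (E a y \<noteq> E x y))"
  have Tsym: "T x y = T y x" if "x \<in> W" "y \<in> W" for x y
    using sym[OF that] by (auto simp: T_def)
  have "card (W - {a}) = 4" using a card by simp
  then obtain p q r s where dist: "distinct [p, q, r, s]" and Wa: "W - {a} = {p, q, r, s}"
    and rows: "adj_rows T [p, q, r, s] \<in> set (path4_rows # nonpath4_rows)"
    using order_four[of "W - {a}" T] Tsym by blast
  have W: "W = {a, p, q, r, s}" "distinct [a, p, q, r, s]" using a Wa dist by auto
  have "adj_rows T [p, q, r, s] \<notin> set nonpath4_rows"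
    using nonsing_on_seidel_five[of a p q r s E T] sym sing W by (auto simp: T_def)
  hence path: "adj_rows T [p, q, r, s] = path4_rows" using rows by simp
  have Tp: "T p q" "\<not> T p r" "\<not> T p s" "T q r" "\<not> T q s" "T r s"
    using path by (simp_all add: path4_rows_def)
  let ?ws = "[a, p, q, r, s]"
  \<comment> \<open>\<open>T x y\<close> is the exclusive or of \<open>E a x\<close>,
    \<open>E a y\<close> and \<open>E x y\<close>, so a known \<open>T\<close> expresses every edge
    on the path through the edges at \<open>a\<close>.\<close>
  have adj: "adj_rows E ?ws = switch_path4 (E a p) (E a q) (E a r) (E a s)"
    using Tp by (auto simp: switch_path4_def T_def)
  have W': "set ?ws = W" using W by simp
  have s: "\<And>x y. x \<in> set ?ws \<Longrightarrow> y \<in> set ?ws \<Longrightarrow> E x y = E y x" using sym W' by blast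
  have "\<not> rows_universal (length ?ws) (adj_rows E ?ws)"
  proof
    assume "rows_universal (length ?ws) (adj_rows E ?ws)"
    from rows_universalD[OF s this] obtain u where "u \<in> W" "\<forall>v\<in>W. v \<noteq> u \<longrightarrow> E u v"
      unfolding W' by blast
    thus False using nu by blast
  qed
  moreover have "rows_universal 5 (switch_path4 i j k l) \<or> rows_classified 5 rows5 (switch_path4 i j k l)"
    for i j k l
  proof -
    have "(i, j, k, l) \<in> set (List.product [True, False]
        (List.product [True, False] (List.product [True, False] [True, False])))"
      by (cases i; cases j; cases k; cases l) simp_all
    from bspec[OF switch_path4_classification[unfolded list_all_iff] this] show ?thesis by simp
  qed
  moreover have "length ?ws = 5" by simp
  ultimately have "rows_classified (length ?ws) rows5 (adj_rows E ?ws)"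
    unfolding adj by metis
  from rows_classifiedD[OF s W(2) this] show ?thesis using W' by simp
qed

text \<open>In C5 every vertex has two neighbours and two non-neighbours, so the all-ones vector is
  in the kernel. The other two graphs arise from C5 by switching, which changes the signs of the
  kernel vector on the switched vertices.\<close>

lemma singular_if_realizes_5:
  assumes sym: "\<And>x y. x \<in> W \<Longrightarrow> y \<in> W \<Longrightarrow> E x y = E y x"
    and R: "R \<in> set rows5" and real: "realizes E W R"
  shows "\<not> nonsing_on (seidel E) W"
proof -
  obtain ws where ws: "distinct ws" "set ws = W" "adj_rows E ws = R"
    using real by (auto simp: realizes_def)
  have "length ws = 5" using arg_cong[OF ws(3), of length] R by (auto simp: rows5_def)
  then obtain a b c e f where abc: "ws = [a, b, c, e, f]"
    by (auto simp: length_Suc_conv numeral_eq_Suc)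
  have W: "W = {a, b, c, e, f}" and dist: "distinct [a, b, c, e, f]" using ws abc by auto
  have sy: "E b a = E a b" "E c a = E a c" "E e a = E a e" "E f a = E a f" "E c b = E b c"
    "E e b = E b e" "E f b = E b f" "E e c = E c e" "E f c = E c f" "E f e = E e f"
    using sym W by auto
  have ne: "b \<noteq> a" "c \<noteq> a" "e \<noteq> a" "f \<noteq> a" "c \<noteq> b" "e \<noteq> b" "f \<noteq> b" "e \<noteq> c" "f \<noteq> c" "f \<noteq> e"
    using dist by auto
  have sum: "(\<Sum>v\<in>W. g v) = g a + (g b + (g c + (g e + g f)))" for g :: "'a \<Rightarrow> real"
    using dist by (simp add: W)
  have sing: "\<not> nonsing_on (seidel E) W"
    if "x a \<noteq> 0" "\<And>u. u \<in> {a, b, c, e, f} \<Longrightarrow> (\<Sum>v\<in>W. seidel E u v * x v) = 0" for x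
    using that unfolding nonsing_on_def by (auto simp: W)
  consider "R = rows5 ! 0" | "R = rows5 ! 1" | "R = rows5 ! 2" using R by (auto simp: rows5_def)
  thus ?thesis
  proof cases
    case 1
    hence "adj_rows E [a, b, c, e, f] = rows5 ! 0" using ws(3) abc by metis
    hence "E a b" "\<not> E a c" "\<not> E a e" "E a f" "E b c" "\<not> E b e" "\<not> E b f" "E c e" "\<not> E c f" "E e f"
      by (simp_all add: rows5_def)
    thus ?thesis using dist ne sy
      by (intro sing[of "\<lambda>_. 1"]; (elim insertE emptyE)?) (simp_all add: sum seidel_def edge_sign_def)
  next
    case 2
    hence "adj_rows E [a, b, c, e, f] = rows5 ! 1" using ws(3) abc by metis
    hence "\<not> E a b" "\<not> E a c" "\<not> E a e" "\<not> E a f" "E b c" "\<not> E b e" "\<not> E b f" "E c e" "\<not> E c f" "E e f"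
      by (simp_all add: rows5_def)
    thus ?thesis using dist ne sy
      \<comment> \<open>The vertices \<open>b\<close> and \<open>f\<close> are the ends of the
        path.\<close>
      by (intro sing[of "\<lambda>v. if v = b \<or> v = f then - 1 else 1"]; (elim insertE emptyE)?)
        (simp_all add: sum seidel_def edge_sign_def)
  next
    case 3
    hence "adj_rows E [a, b, c, e, f] = rows5 ! 2" using ws(3) abc by metis
    hence "E a b" "E a c" "E a e" "\<not> E a f" "E b c" "\<not> E b e" "E b f" "\<not> E c e" "\<not> E c f" "\<not> E e f"
      by (simp_all add: rows5_def)
    thus ?thesis using dist ne sy
      \<comment> \<open>The vertex \<open>c\<close> is the triangle vertex without a pendant
        neighbour.\<close>
      by (intro sing[of "\<lambda>v. if v = c then - 1 else 1"]; (elim insertE emptyE)?)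
        (simp_all add: sum seidel_def edge_sign_def)
  qed
qed

section \<open>Graphs with a universal vertex\<close>

context graph_distance begin

abbreviation adjacent :: "'a \<Rightarrow> 'a \<Rightarrow> bool" where
  "adjacent u v \<equiv> d u v = 1"

definition others :: "'a set" where
  "others = {v \<in> V. \<not> universal v}"

text \<open>In the presence of a second vertex, the eccentricity of \<open>u\<close> is 1, and every
  distance from \<open>u\<close> attains it. So row \<open>u\<close> of M consists of ones.\<close>

lemma shifted_universal:
  assumes "universal u" "v \<in> V"
  shows "shifted u v = 1"
proof (cases "u = v")
  case False
  have u: "u \<in> V" and duv: "d u v = 1" using assms False by (auto simp: universal_def)
  obtain w where w: "w \<in> V" "d w u = ecc u" using ecc_attained by blast
  have "ecc u \<le> 1" using w u assms(1) sym[of w u] by (cases "w = u") (auto simp: universal_def)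
  moreover have "1 \<le> ecc u" "1 \<le> ecc v" using d_le_ecc[of v u] d_le_ecc[of u v] duv sym[of u v] u assms(2) by auto
  ultimately show ?thesis using False duv by (simp add: shifted_def far_def)
qed (use assms in simp)

lemma ecc_others:
  assumes "universal u" "v \<in> others"
  shows "ecc v = 2"
proof -
  have v: "v \<in> V" "\<not> universal v" using assms by (auto simp: others_def)
  have "v \<noteq> u" using assms by (auto simp: others_def)
  hence u: "u \<in> V" "d u v = 1" using assms(1) v(1) by (auto simp: universal_def)
  obtain w where w: "w \<in> V" "d w v = ecc v" using ecc_attained by blast
  have "d w u \<le> 1" using w(1) assms(1) sym[of w u] u by (cases "w = u") (auto simp: universal_def)
  hence "ecc v \<le> 2" using triangle[of w u v] w u v by simp
  thus ?thesis using two_le_ecc[OF v] by simp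
qed

text \<open>All eccentricities here are 2, so M has entries 1, 0 and 2 on the diagonal, at edges and
  at non-edges: it is the Seidel matrix plus J.\<close>

lemma shifted_others:
  assumes u: "universal u" and "v \<in> others" "w \<in> others"
  shows "real_of_int (shifted v w) = seidel adjacent v w + 1"
proof (cases "v = w")
  case False
  have "ecc v = 2" "ecc w = 2" using ecc_others assms by auto
  moreover have "v \<in> V" "w \<in> V" using assms by (auto simp: others_def)
  moreover have "d v w \<noteq> 0" using False d_eq_0 calculation by auto
  moreover have "d v w \<le> 2" using d_le_ecc[of v w] calculation by auto
  ultimately have "d v w = 1 \<or> d v w = 2" by linarith
  thus ?thesis using False \<open>ecc v = 2\<close> \<open>ecc w = 2\<close>
    by (auto simp: shifted_def far_def seidel_def edge_sign_def)
qed (use assms in \<open>simp add: seidel_def others_def\<close>)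

text \<open>A nonuniversal vertex has a non-neighbour, which is nonuniversal as well.\<close>

lemma card_others_neq_1: "card others \<noteq> 1"
proof
  assume "card others = 1"
  then obtain v where v: "others = {v}" by (auto simp: card_1_singleton_iff)
  hence "v \<in> V" "\<not> universal v" by (auto simp: others_def)
  then obtain w where w: "w \<in> V" "w \<noteq> v" "d v w \<noteq> 1" by (auto simp: universal_def)
  hence "universal w" using v by (auto simp: others_def)
  hence "d w v = 1" using \<open>v \<in> V\<close> w by (auto simp: universal_def)
  thus False using sym[of v w] w \<open>v \<in> V\<close> by simp
qed

lemma others_nonadjacent: "u \<in> others \<Longrightarrow> \<exists>v\<in>others. v \<noteq> u \<and> \<not> adjacent u v"
  unfolding others_def universal_def using sym by fastforce

lemma nonsing_others:
  assumes "universal u"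
  shows "nonsing others"
  by (rule nonsing_on_if_dvd_ecc[of _ 2]) (use ecc_others[OF assms] in \<open>auto simp: others_def\<close>)

text \<open>Row \<open>u\<close> makes the entries of a kernel vector sum to zero. Subtracting it
  from the rows of \<open>others\<close> removes J and leaves the Seidel matrix.\<close>

lemma nonsing_insert_universal:
  assumes u: "universal u" and ns: "nonsing_on (seidel adjacent) others"
  shows "nonsing (insert u others)"
  unfolding nonsing_on_def
proof (intro allI impI)
  fix x :: "'a \<Rightarrow> real"
  assume x: "\<forall>v\<in>insert u others. (\<Sum>w\<in>insert u others. shifted v w * x w) = 0"
  have uV: "u \<in> V" and un: "u \<notin> others" using u by (auto simp: universal_def others_def)
  have fin: "finite others" using finite by (simp add: others_def)
  have oV: "v \<in> V" if "v \<in> others" for v using that by (simp add: others_def)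
  have "(\<Sum>w\<in>others. shifted u w * x w) = (\<Sum>w\<in>others. x w)"
    by (intro sum.cong) (auto simp: shifted_universal[OF u] oV)
  hence xu: "x u = - (\<Sum>w\<in>others. x w)"
    using bspec[OF x, of u] fin un uV by simp
  have "(\<Sum>w\<in>others. seidel adjacent v w * x w) = 0" if v: "v \<in> others" for v
  proof -
    have "(\<Sum>w\<in>others. shifted v w * x w) = (\<Sum>w\<in>others. seidel adjacent v w * x w) + (\<Sum>w\<in>others. x w)"
      unfolding sum.distrib[symmetric]
      by (intro sum.cong) (auto simp: shifted_others[OF u v] algebra_simps)
    moreover have "shifted v u = 1" using shifted_sym[of v u] shifted_universal[OF u] oV v uV by simp
    ultimately show ?thesis using bspec[OF x, of v] v fin un xu by simp
  qed
  hence "\<forall>v\<in>others. x v = 0" using ns unfolding nonsing_on_def by blast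
  thus "\<forall>v\<in>insert u others. x v = 0" using xu by simp
qed

end

section \<open>The multiplicity in terms of nonuniversal vertices\<close>

locale graph_spectrum = graph_distance +
  fixes vs :: "'a list"
  assumes distinct: "distinct vs" and set_vs: "set vs = V"
begin

definition mult :: nat where
  "mult = eigenvalue_multiplicity (fun_mat (\<lambda>u v. real (far u v)) vs) (- 1)"

lemma length_vs: "length vs = card V"
  using distinct_card[OF distinct] set_vs by simp

lemma nonsing_card_le:
  assumes "S \<subseteq> V" "nonsing S"
  shows "mult + card S \<le> card V"
proof -
  have "nonsing_on (\<lambda>u v. real (far u v) - (if u = v then - 1 else 0)) S"
    using assms(2) by (rule iffD1[OF nonsing_on_cong, rotated]) (simp add: shifted_def)
  thus ?thesis unfolding mult_def length_vs[symmetric]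
    by (intro multiplicity_add_card_nonsing_le[OF distinct]) (use assms far_sym set_vs in auto)
qed

text \<open>Kernel vectors of M are eigenvectors for -1; the normalised family has one member for
  each vertex outside \<open>T\<close>.\<close>

lemma kernel_card_le:
  fixes z :: "'a \<Rightarrow> 'a \<Rightarrow> real"
  assumes T: "T \<subseteq> V"
    and z1: "\<And>v. v \<in> V - T \<Longrightarrow> z v v = 1"
    and z0: "\<And>u v. v \<in> V - T \<Longrightarrow> u \<in> V - T \<Longrightarrow> u \<noteq> v \<Longrightarrow> z v u = 0"
    and ker: "\<And>u v. v \<in> V - T \<Longrightarrow> u \<in> V \<Longrightarrow> (\<Sum>w\<in>V. shifted u w * z v w) = 0"
  shows "card V \<le> mult + card T"
  unfolding mult_def length_vs[symmetric]
proof (rule eigenvectors_le_multiplicity[OF distinct, where z = z])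
  fix u v assume uv: "v \<in> set vs - T" "u \<in> set vs"
  have "(\<Sum>w\<in>V. shifted u w * z v w)
      = (\<Sum>w\<in>V. real (far u w) * z v w) + (\<Sum>w\<in>V. if w = u then z v w else 0)"
    unfolding sum.distrib[symmetric] by (intro sum.cong) (auto simp: shifted_def algebra_simps)
  thus "(\<Sum>w\<in>set vs. real (far u w) * z v w) = - 1 * z v u"
    using ker[of v u] uv finite by (simp add: set_vs)
qed (use T z1 z0 set_vs in auto)

text \<open>Since M is nonsingular on \<open>others\<close>, the rank is at least
  \<open>card others\<close>. Universal vertices have equal columns, so all but one of them yield
  kernel vectors. The last unit of rank depends on whether a kernel vector of the Seidel matrix
  extends to M.\<close>

lemma mult_universal:
  assumes u: "universal u"
  shows "mult + card others \<le> card V" "card V \<le> mult + card others + 1"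
    and "nonsing_on (seidel adjacent) others \<Longrightarrow> mult + card others + 1 = card V"
    and "\<not> nonsing_on (seidel adjacent) others \<Longrightarrow> mult + card others = card V"
proof -
  have uV: "u \<in> V" and un: "u \<notin> others" using u by (auto simp: universal_def others_def)
  have fin: "finite others" using finite by (simp add: others_def)
  have oV: "others \<subseteq> V" by (auto simp: others_def)
  show le: "mult + card others \<le> card V"
    by (rule nonsing_card_le[OF oV nonsing_others[OF u]])
  let ?T = "insert u others"
  have univ: "universal v" if "v \<in> V - others" for v using that by (simp add: others_def)
  have one: "shifted w v = 1" if "v \<in> V - others" "w \<in> V" for v w
    using shifted_universal[OF univ[OF that(1)] that(2)] shifted_sym[of w v] that by simp
  show ge: "card V \<le> mult + card others + 1"
  proof -
    \<comment> \<open>The difference of the unit vectors at the universal vertices \<open>v\<close>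
      and \<open>u\<close>.\<close>
    define z :: "'a \<Rightarrow> 'a \<Rightarrow> real" where "z = (\<lambda>v w. if w = v then 1 else if w = u then - 1 else 0)"
    have "card V \<le> mult + card ?T"
    proof (rule kernel_card_le[of _ z])
      fix w v assume wv: "v \<in> V - ?T" "w \<in> V"
      have "(\<Sum>x\<in>V. shifted w x * z v x)
          = (\<Sum>x\<in>V. (if x = v then real_of_int (shifted w x) else 0)
            - (if x = u then real_of_int (shifted w x) else 0))"
        using wv by (intro sum.cong) (auto simp: z_def)
      also have "\<dots> = shifted w v - shifted w u"
        using wv uV finite by (simp add: sum_subtractf)
      also have "\<dots> = 0" using one[of v w] one[of u w] wv uV un by simp
      finally show "(\<Sum>x\<in>V. shifted w x * z v x) = 0" by simp
    qed (use uV oV in \<open>auto simp: z_def\<close>)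
    thus ?thesis using fin un by simp
  qed
  show "mult + card others + 1 = card V" if "nonsing_on (seidel adjacent) others"
    using nonsing_card_le[OF _ nonsing_insert_universal[OF u that]] uV oV ge fin un by simp
  show "mult + card others = card V" if sing: "\<not> nonsing_on (seidel adjacent) others"
  proof -
    obtain x where x: "\<forall>v\<in>others. (\<Sum>w\<in>others. seidel adjacent v w * x w) = 0"
      and "\<exists>v\<in>others. x v \<noteq> 0"
      using sing unfolding nonsing_on_def by blast
    then obtain t where t: "t \<in> others" "x t \<noteq> 0" by blast
    \<comment> \<open>A kernel vector of the Seidel matrix, scaled to 1 at \<open>t\<close>. The
      value at \<open>u\<close> makes the total sum zero, which cancels J and handles the rows of
      universal vertices.\<close>
    define y where "y = (\<lambda>w. if w \<in> others then x w / x t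
      else if w = u then - (\<Sum>w\<in>others. x w / x t) else 0)"
    have y: "(\<Sum>w\<in>V. shifted v w * y w) = 0" if v: "v \<in> V" for v
    proof -
      have "(\<Sum>w\<in>V. shifted v w * y w) = (\<Sum>w\<in>?T. shifted v w * y w)"
        using uV oV finite by (intro sum.mono_neutral_right) (auto simp: y_def)
      also have "\<dots> = shifted v u * y u + (\<Sum>w\<in>others. shifted v w * y w)"
        using fin un by simp
      also have "\<dots> = (\<Sum>w\<in>others. (real_of_int (shifted v w) - 1) * (x w / x t))"
      proof -
        have "shifted v u = 1" using one[of u v] uV un v by simp
        moreover have "y u = - (\<Sum>w\<in>others. x w / x t)" using un by (simp add: y_def)
        moreover have "(\<Sum>w\<in>others. shifted v w * y w) = (\<Sum>w\<in>others. shifted v w * (x w / x t))"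
          by (intro sum.cong) (auto simp: y_def)
        ultimately show ?thesis by (simp add: left_diff_distrib diff_divide_distrib sum_subtractf)
      qed
      also have "\<dots> = 0"
      proof (cases "v \<in> others")
        case True
        have "(\<Sum>w\<in>others. (real_of_int (shifted v w) - 1) * (x w / x t))
            = (\<Sum>w\<in>others. seidel adjacent v w * x w) / x t"
          unfolding sum_divide_distrib
          by (intro sum.cong) (auto simp: shifted_others[OF u True])
        thus ?thesis using x True by simp
      next
        case False
        have "shifted v w = 1" if "w \<in> others" for w
          using shifted_universal[OF univ, of v w] False v oV that by auto
        thus ?thesis by simp
      qed
      finally show ?thesis .
    qed
    define z :: "'a \<Rightarrow> 'a \<Rightarrow> real" where
      "z = (\<lambda>v. if v = t then y else (\<lambda>w. if w = v then 1 else if w = u then - 1 else 0))"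
    \<comment> \<open>Now \<open>t\<close> also has its kernel vector \<open>y\<close>, which
      vanishes at all universal vertices but \<open>u\<close>; the exceptional set therefore loses
      \<open>t\<close>.\<close>
    let ?T' = "insert u (others - {t})"
    have "card V \<le> mult + card ?T'"
    proof (rule kernel_card_le[of _ z])
      fix w v assume wv: "v \<in> V - ?T'" "w \<in> V"
      show "(\<Sum>p\<in>V. shifted w p * z v p) = 0"
      proof (cases "v = t")
        case True
        thus ?thesis using y wv by (simp add: z_def)
      next
        case False
        have "(\<Sum>p\<in>V. shifted w p * z v p)
            = (\<Sum>p\<in>V. (if p = v then real_of_int (shifted w p) else 0)
            - (if p = u then real_of_int (shifted w p) else 0))"
          using wv False by (intro sum.cong) (auto simp: z_def)
        also have "\<dots> = shifted w v - shifted w u"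
          using wv uV finite by (simp add: sum_subtractf)
        also have "\<dots> = 0" using one[of v w] one[of u w] wv uV un False by simp
        finally show ?thesis by simp
      qed
    next
      show "?T' \<subseteq> V" using uV oV by blast
      show "z v v = 1" if "v \<in> V - ?T'" for v
        using that t by (cases "v = t") (simp_all add: z_def y_def)
      show "z v w = 0" if v: "v \<in> V - ?T'" and w: "w \<in> V - ?T'" and ne: "w \<noteq> v" for w v
      proof (cases "v = t")
        case True
        hence "w \<notin> others" "w \<noteq> u" using w ne by auto
        thus ?thesis using True by (simp add: z_def y_def)
      next
        case False
        thus ?thesis using w ne by (simp add: z_def)
      qed
    qed
    moreover have "card ?T' = Suc (card (others - {t}))"
      using fin un by (intro card_insert_disjoint) auto
    hence "card ?T' = card others" using card.remove[OF fin t(1)] by simp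
    ultimately show ?thesis using le by simp
  qed
qed

end

section \<open>Isomorphisms and joins with complete graphs\<close>

text \<open>An arc of a pair digraph is the pair of its ends, so the arc part of an isomorphism is
  forced by its vertex part.\<close>

lemma isomorphic_iff_map:
  assumes "pair_wf_digraph G"
  shows "isomorphic G H \<longleftrightarrow> (\<exists>f. inj_on f (pverts G) \<and> pverts H = f ` pverts G
    \<and> parcs H = map_prod f f ` parcs G)"
proof
  assume "isomorphic G H"
  then obtain h where h: "pre_digraph.digraph_isomorphism (with_proj G) h"
    and H: "with_proj H = app_iso h (with_proj G)"
    by (auto simp: isomorphic_def digraph_iso_def)
  have tail: "iso_tail h = fst" and head: "iso_head h = snd"
    using arg_cong[OF H, of tail] arg_cong[OF H, of head] by simp_all
  have "iso_arcs h a = map_prod (iso_verts h) (iso_verts h) a" if "a \<in> parcs G" for a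
    using h that unfolding pre_digraph.digraph_isomorphism_def tail head
    by (auto simp: prod_eq_iff)
  moreover have "parcs H = iso_arcs h ` parcs G" using arg_cong[OF H, of arcs] by simp
  ultimately have "parcs H = map_prod (iso_verts h) (iso_verts h) ` parcs G" by simp
  moreover have "pverts H = iso_verts h ` pverts G" using arg_cong[OF H, of verts] by simp
  moreover have "inj_on (iso_verts h) (pverts G)"
    using h by (simp add: pre_digraph.digraph_isomorphism_def)
  ultimately show "\<exists>f. inj_on f (pverts G) \<and> pverts H = f ` pverts G \<and> parcs H = map_prod f f ` parcs G"
    by blast
next
  assume "\<exists>f. inj_on f (pverts G) \<and> pverts H = f ` pverts G \<and> parcs H = map_prod f f ` parcs G"
  then obtain f where f: "inj_on f (pverts G)" "pverts H = f ` pverts G"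
    "parcs H = map_prod f f ` parcs G" by blast
  interpret G: pair_wf_digraph G by fact
  let ?h = "\<lparr>iso_verts = f, iso_arcs = map_prod f f, iso_head = snd, iso_tail = fst\<rparr>"
  have "inj_on (map_prod f f) (parcs G)"
    by (rule inj_on_subset[OF map_prod_inj_on[OF f(1) f(1)]]) (auto dest: G.wellformed')
  moreover have "wf_digraph (with_proj G)" by unfold_locales
  ultimately have "pre_digraph.digraph_isomorphism (with_proj G) ?h"
    using f(1) by (simp add: pre_digraph.digraph_isomorphism_def)
  moreover have "with_proj H = app_iso ?h (with_proj G)"
    using f by (simp add: app_iso_def with_proj_def)
  ultimately show "isomorphic G H" by (auto simp: isomorphic_def digraph_iso_def)
qed

definition simple_graph :: "'a pair_pre_digraph \<Rightarrow> bool" where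
  "simple_graph H \<longleftrightarrow> parcs H \<subseteq> pverts H \<times> pverts H \<and> sym (parcs H) \<and> irrefl (parcs H)"

lemma isomorphic_iff_bij:
  assumes "simple_graph G" "simple_graph H"
  shows "isomorphic G H \<longleftrightarrow> (\<exists>f. bij_betw f (pverts G) (pverts H) \<and>
    (\<forall>u\<in>pverts G. \<forall>v\<in>pverts G. (u, v) \<in> parcs G \<longleftrightarrow> (f u, f v) \<in> parcs H))"
proof -
  have "pair_wf_digraph G" using assms(1) by unfold_locales (auto simp: simple_graph_def)
  have "(inj_on f (pverts G) \<and> pverts H = f ` pverts G \<and> parcs H = map_prod f f ` parcs G) \<longleftrightarrow>
    (bij_betw f (pverts G) (pverts H) \<and>
      (\<forall>u\<in>pverts G. \<forall>v\<in>pverts G. (u, v) \<in> parcs G \<longleftrightarrow> (f u, f v) \<in> parcs H))" (is "?L \<longleftrightarrow> ?R") for f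
  proof
    assume L: ?L
    have "(u, v) \<in> parcs G" if uv: "u \<in> pverts G" "v \<in> pverts G" "(f u, f v) \<in> parcs H" for u v
    proof -
      obtain x y where xy: "(x, y) \<in> parcs G" "f x = f u" "f y = f v" using L uv(3) by auto
      hence "x \<in> pverts G" "y \<in> pverts G" using assms(1) by (auto simp: simple_graph_def)
      hence "x = u" "y = v" using L uv(1,2) xy by (auto dest: inj_onD)
      thus ?thesis using xy by simp
    qed
    thus ?R using L by (force simp: bij_betw_def)
  next
    assume R: ?R
    have "parcs H = map_prod f f ` parcs G"
    proof (intro subset_antisym subsetI)
      fix a assume a: "a \<in> parcs H"
      then obtain x y where xy: "a = (x, y)" "x \<in> pverts H" "y \<in> pverts H"
        using assms(2) by (cases a) (auto simp: simple_graph_def)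
      then obtain u v where "u \<in> pverts G" "v \<in> pverts G" "x = f u" "y = f v"
        using R by (metis bij_betw_imp_surj_on imageE)
      moreover from this have "(u, v) \<in> parcs G" using R a xy by blast
      ultimately show "a \<in> map_prod f f ` parcs G" using xy by force
    next
      fix a assume "a \<in> map_prod f f ` parcs G"
      thus "a \<in> parcs H" using R assms(1) by (auto simp: simple_graph_def)
    qed
    thus ?L using R by (auto simp: bij_betw_def)
  qed
  thus ?thesis unfolding isomorphic_iff_map[OF \<open>pair_wf_digraph G\<close>] by blast
qed

section \<open>Disjoint unions and joins by parity\<close>

lemma in_double_image: "x \<in> (\<lambda>i. 2 * i) ` A \<longleftrightarrow> even x \<and> x div 2 \<in> A" for x :: nat
  by (auto elim!: evenE)

lemma in_Suc_double_image: "x \<in> (\<lambda>i. 2 * i + 1) ` A \<longleftrightarrow> odd x \<and> x div 2 \<in> A" for x :: nat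
  by (auto elim!: oddE)

lemma in_map_prod_double:
  "(x, y) \<in> map_prod (\<lambda>i. 2 * i) (\<lambda>i. 2 * i) ` R \<longleftrightarrow> even x \<and> even y \<and> (x div 2, y div 2) \<in> R"
  for x y :: nat
  by (force elim!: evenE simp: image_iff)

lemma in_map_prod_Suc_double:
  "(x, y) \<in> map_prod (\<lambda>i. 2 * i + 1) (\<lambda>i. 2 * i + 1) ` R \<longleftrightarrow> odd x \<and> odd y \<and> (x div 2, y div 2) \<in> R"
  for x y :: nat
  by (force elim!: oddE simp: image_iff)

lemma in_pverts_disj_union:
  "x \<in> pverts (G \<oplus>\<^sub>g H) \<longleftrightarrow> (if even x then x div 2 \<in> pverts G else x div 2 \<in> pverts H)"
  unfolding disj_union_def Let_def pair_pre_digraph.simps Un_iff in_double_image in_Suc_double_image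
  by auto

lemma in_parcs_disj_union:
  "(x, y) \<in> parcs (G \<oplus>\<^sub>g H) \<longleftrightarrow> even x \<and> even y \<and> (x div 2, y div 2) \<in> parcs G
    \<or> odd x \<and> odd y \<and> (x div 2, y div 2) \<in> parcs H"
  unfolding disj_union_def Let_def pair_pre_digraph.simps Un_iff in_map_prod_double in_map_prod_Suc_double ..

lemma in_pverts_join:
  "x \<in> pverts (G \<or>\<^sub>g H) \<longleftrightarrow> (if even x then x div 2 \<in> pverts G else x div 2 \<in> pverts H)"
  by (simp add: join_def Let_def in_pverts_disj_union)

lemma in_parcs_join:
  "(x, y) \<in> parcs (G \<or>\<^sub>g H) \<longleftrightarrow>
    even x \<and> even y \<and> (x div 2, y div 2) \<in> parcs G
    \<or> odd x \<and> odd y \<and> (x div 2, y div 2) \<in> parcs H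
    \<or> even x \<and> odd y \<and> x div 2 \<in> pverts G \<and> y div 2 \<in> pverts H
    \<or> odd x \<and> even y \<and> x div 2 \<in> pverts H \<and> y div 2 \<in> pverts G"
  unfolding join_def Let_def pair_pre_digraph.simps Un_iff mem_Sigma_iff in_parcs_disj_union
    in_double_image in_Suc_double_image
  by auto

lemma simple_complete_graph: "simple_graph (complete_graph k)"
  by (auto simp: simple_graph_def complete_graph_def sym_def irrefl_def)

lemma simple_path_graph: "simple_graph (path_graph k)"
  by (auto simp: simple_graph_def path_graph_def sym_def irrefl_def)

lemma simple_cycle_graph: "k \<ge> 3 \<Longrightarrow> simple_graph (cycle_graph k)"
  by (auto simp: simple_graph_def cycle_graph_def sym_def irrefl_def mod_Suc)

lemma simple_bull_graph: "simple_graph bull_graph"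
  by (auto simp: simple_graph_def bull_graph_def sym_def irrefl_def Let_def)

lemma simple_disj_union: "simple_graph G \<Longrightarrow> simple_graph H \<Longrightarrow> simple_graph (G \<oplus>\<^sub>g H)"
  unfolding simple_graph_def sym_def irrefl_def
  by (auto simp: in_pverts_disj_union in_parcs_disj_union)

lemma simple_join: "simple_graph G \<Longrightarrow> simple_graph H \<Longrightarrow> simple_graph (G \<or>\<^sub>g H)"
  unfolding simple_graph_def sym_def irrefl_def
  by (auto simp: in_pverts_join in_parcs_join)

lemma simple_copies: "simple_graph G \<Longrightarrow> simple_graph (copies k G)"
proof (induction k)
  case 0
  show ?case by (simp add: simple_graph_def sym_def irrefl_def)
qed (simp add: simple_disj_union)

lemmas simple_graphs = simple_complete_graph simple_path_graph simple_cycle_graph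
  simple_bull_graph simple_disj_union simple_copies

text \<open>A graph with a universal vertex is not coded: it would be ambiguous as the second operand of
  a join with a complete graph.\<close>

definition coded_by :: "nat pair_pre_digraph \<Rightarrow> bool list list \<Rightarrow> bool" where
  "coded_by H R \<longleftrightarrow> simple_graph H \<and> (\<forall>x\<in>pverts H. \<exists>y\<in>pverts H. y \<noteq> x \<and> (x, y) \<notin> parcs H) \<and>
    (\<exists>hs. distinct hs \<and> set hs = pverts H \<and> adj_rows (\<lambda>x y. (x, y) \<in> parcs H) hs = R)"

lemma coded_byI:
  assumes "simple_graph H" "distinct hs" "set hs = pverts H"
    "adj_rows (\<lambda>x y. (x, y) \<in> parcs H) hs = R"
    "\<forall>x\<in>set hs. \<exists>y\<in>set hs. y \<noteq> x \<and> (x, y) \<notin> parcs H"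
  shows "coded_by H R"
  using assms unfolding coded_by_def by metis

lemma pverts_simps:
  "pverts (complete_graph k) = {..<k}" "pverts (path_graph k) = {..<k}"
  "pverts (cycle_graph k) = {..<k}" "pverts bull_graph = {..<5}"
  "pverts (G \<oplus>\<^sub>g H) = (\<lambda>i. 2 * i) ` pverts G \<union> (\<lambda>i. 2 * i + 1) ` pverts H"
  by (simp_all add: complete_graph_def path_graph_def cycle_graph_def bull_graph_def
      disj_union_def Let_def)

lemma lessThan_numerals: "{..<1::nat} = {0}" "{..<2::nat} = {0, 1}" "{..<3::nat} = {0, 1, 2}"
  "{..<4::nat} = {0, 1, 2, 3}" "{..<5::nat} = {0, 1, 2, 3, 4}"
  by auto

lemma in_parcs_simps:
  "(x, y) \<in> parcs (complete_graph k) \<longleftrightarrow> x < k \<and> y < k \<and> x \<noteq> y"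
  "(x, y) \<in> parcs (path_graph k) \<longleftrightarrow> x < k \<and> y < k \<and> (y = x + 1 \<or> x = y + 1)"
  "(x, y) \<in> parcs (cycle_graph k) \<longleftrightarrow> x < k \<and> y < k \<and> (y = (x + 1) mod k \<or> x = (y + 1) mod k)"
  "(x, y) \<in> parcs bull_graph \<longleftrightarrow>
    (x, y) \<in> {(0, 1), (1, 2), (2, 0), (3, 0), (4, 1), (1, 0), (2, 1), (0, 2), (0, 3), (1, 4)}"
  by (auto simp: complete_graph_def path_graph_def cycle_graph_def bull_graph_def Let_def)

lemma copies_numeral: "copies (numeral k) G = G \<oplus>\<^sub>g copies (pred_numeral k) G"
  by (simp add: numeral_eq_Suc)

lemmas coding_simps = pverts_simps lessThan_numerals in_parcs_simps in_parcs_disj_union copies_numeral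

section \<open>Codes of the graphs in the theorem\<close>

text \<open>The lists follow the placement of operands on even and odd numbers: in iterated copies
  of K1 the vertices become 0, 1, 3, 7.\<close>

lemma coded_by_order_2_3:
  "coded_by (copies 2 (complete_graph 1)) [[False], []]"
  "coded_by (complete_graph 2 \<oplus>\<^sub>g complete_graph 1) [[True, False], [False], []]"
  "coded_by (copies 3 (complete_graph 1)) [[False, False], [False], []]"
  subgoal by (rule coded_byI[of _ "[0, 1]"]; (intro simple_graphs; simp)?) (auto simp: coding_simps)
  subgoal by (rule coded_byI[of _ "[0, 2, 1]"]; (intro simple_graphs; simp)?) (auto simp: coding_simps)
  subgoal by (rule coded_byI[of _ "[0, 1, 3]"]; (intro simple_graphs; simp)?) (auto simp: coding_simps)
  done

lemma coded_by_order_4: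
  "coded_by (copies 4 (complete_graph 1)) (rows4 ! 0)"
  "coded_by (copies 2 (complete_graph 1) \<oplus>\<^sub>g complete_graph 2) (rows4 ! 1)"
  "coded_by (path_graph 3 \<oplus>\<^sub>g complete_graph 1) (rows4 ! 2)"
  "coded_by (copies 2 (complete_graph 2)) (rows4 ! 3)"
  "coded_by (path_graph 4) (rows4 ! 4)"
  "coded_by (complete_graph 3 \<oplus>\<^sub>g complete_graph 1) (rows4 ! 5)"
  "coded_by (cycle_graph 4) (rows4 ! 6)"
  subgoal by (rule coded_byI[of _ "[0, 1, 3, 7]"]; (intro simple_graphs; simp)?) (auto simp: coding_simps rows4_def)
  subgoal by (rule coded_byI[of _ "[0, 2, 1, 3]"]; (intro simple_graphs; simp)?) (auto simp: coding_simps rows4_def)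
  subgoal by (rule coded_byI[of _ "[0, 2, 4, 1]"]; (intro simple_graphs; simp)?) (auto simp: coding_simps rows4_def)
  subgoal by (rule coded_byI[of _ "[0, 2, 1, 5]"]; (intro simple_graphs; simp)?) (auto simp: coding_simps rows4_def)
  subgoal by (rule coded_byI[of _ "[0, 1, 2, 3]"]; (intro simple_graphs; simp)?) (auto simp: coding_simps rows4_def)
  subgoal by (rule coded_byI[of _ "[0, 2, 4, 1]"]; (intro simple_graphs; simp)?) (auto simp: coding_simps rows4_def)
  subgoal by (rule coded_byI[of _ "[0, 1, 2, 3]"]; (intro simple_graphs; simp)?) (auto simp: coding_simps rows4_def)
  done

lemma coded_by_order_5:
  "coded_by (cycle_graph 5) (rows5 ! 0)"
  "coded_by (complete_graph 1 \<oplus>\<^sub>g path_graph 4) (rows5 ! 1)"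
  "coded_by bull_graph (rows5 ! 2)"
  subgoal by (rule coded_byI[of _ "[0, 1, 2, 3, 4]"]; (intro simple_graphs; simp)?) (auto simp: coding_simps rows5_def)
  subgoal by (rule coded_byI[of _ "[0, 1, 3, 5, 7]"]; (intro simple_graphs; simp)?) (auto simp: coding_simps rows5_def)
  subgoal by (rule coded_byI[of _ "[0, 1, 2, 3, 4]"]; (intro simple_graphs; simp)?) (auto simp: coding_simps rows5_def)
  done

section \<open>Comparison with complete graphs, joins and P4\<close>

locale distance_graph = graph_distance "pverts G" d for G :: "'a pair_pre_digraph" and d +
  assumes simple: "simple_graph G"
    and edge_iff: "u \<in> pverts G \<Longrightarrow> v \<in> pverts G \<Longrightarrow> (u, v) \<in> parcs G \<longleftrightarrow> d u v = 1"
begin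

abbreviation "V \<equiv> pverts G"

lemma isomorphic_complete_graph_iff: "isomorphic G (complete_graph (card V)) \<longleftrightarrow> others = {}"
proof -
  have "isomorphic G (complete_graph (card V)) \<longleftrightarrow> (\<exists>f. bij_betw f V {..<card V} \<and>
      (\<forall>u\<in>V. \<forall>v\<in>V. (u, v) \<in> parcs G \<longleftrightarrow> (f u, f v) \<in> parcs (complete_graph (card V))))"
    unfolding isomorphic_iff_bij[OF simple simple_complete_graph] by (simp add: complete_graph_def)
  also have "\<dots> \<longleftrightarrow> (\<exists>f. bij_betw f V {..<card V} \<and> (\<forall>u\<in>V. \<forall>v\<in>V. d u v = 1 \<longleftrightarrow> u \<noteq> v))"
  proof (intro ex_cong1 conj_cong refl ball_cong)
    fix f u v assume f: "bij_betw f V {..<card V}" and uv: "u \<in> V" "v \<in> V"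
    have "f u < card V" "f v < card V" "f u = f v \<longleftrightarrow> u = v"
      using f uv by (auto simp: bij_betw_def inj_on_eq_iff)
    thus "((u, v) \<in> parcs G \<longleftrightarrow> (f u, f v) \<in> parcs (complete_graph (card V))) \<longleftrightarrow> (d u v = 1 \<longleftrightarrow> u \<noteq> v)"
      using edge_iff[OF uv] by (simp add: complete_graph_def)
  qed
  also have "\<dots> \<longleftrightarrow> (\<forall>u\<in>V. \<forall>v\<in>V. d u v = 1 \<longleftrightarrow> u \<noteq> v)"
    using ex_bij_betw_finite_nat[OF finite] by (auto simp: atLeast0LessThan)
  also have "\<dots> \<longleftrightarrow> others = {}"
    by (auto simp: others_def universal_def)
  finally show ?thesis .
qed

text \<open>As \<open>H\<close> has no universal vertex, the universal vertices of the join are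
  exactly those of its complete part. An isomorphism thus restricts to \<open>others\<close> and
  \<open>H\<close>; conversely, any bijection between the universal vertices completes it.\<close>

lemma isomorphic_join_iff:
  assumes H: "coded_by H R" and card: "card V = k + length R"
  shows "isomorphic G (complete_graph k \<or>\<^sub>g H) \<longleftrightarrow> realizes adjacent others R"
proof -
  obtain hs where hs: "distinct hs" "set hs = pverts H" "adj_rows (\<lambda>x y. (x, y) \<in> parcs H) hs = R"
    and simpleH: "simple_graph H" and nuH: "\<And>x. x \<in> pverts H \<Longrightarrow> \<exists>y\<in>pverts H. y \<noteq> x \<and> (x, y) \<notin> parcs H"
    using H by (auto simp: coded_by_def)
  let ?J = "complete_graph k \<or>\<^sub>g H"
  have vJ: "x \<in> pverts ?J \<longleftrightarrow> (if even x then x div 2 < k else x div 2 \<in> pverts H)" for x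
    by (simp add: in_pverts_join complete_graph_def)
  have len: "length hs = length R" using hs(3) by auto
  have iso: "isomorphic G ?J \<longleftrightarrow> (\<exists>f. bij_betw f V (pverts ?J) \<and>
      (\<forall>u\<in>V. \<forall>v\<in>V. (u, v) \<in> parcs G \<longleftrightarrow> (f u, f v) \<in> parcs ?J))"
    by (rule isomorphic_iff_bij[OF simple simple_join[OF simple_complete_graph simpleH]])
  show ?thesis
  proof
    assume "isomorphic G ?J"
    then obtain f where bij: "bij_betw f V (pverts ?J)"
      and f: "\<And>u v. u \<in> V \<Longrightarrow> v \<in> V \<Longrightarrow> (u, v) \<in> parcs G \<longleftrightarrow> (f u, f v) \<in> parcs ?J"
      using iso by blast
    have fV: "f v \<in> pverts ?J" if "v \<in> V" for v using bij that by (auto simp: bij_betw_def)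
    have fne: "f u \<noteq> f v" if "u \<in> V" "v \<in> V" "u \<noteq> v" for u v
      using bij that by (auto simp: bij_betw_def dest: inj_onD)
    define g where "g = inv_into V f"
    have g: "g x \<in> V" "f (g x) = x" if "x \<in> pverts ?J" for x
      using bij that by (auto simp: g_def bij_betw_def inv_into_into f_inv_into_f)
    have gf: "g (f v) = v" if "v \<in> V" for v
      using bij that by (simp add: g_def bij_betw_def)
    \<comment> \<open>Even numbers carry the complete part. An odd vertex has a non-neighbour inside
      \<open>H\<close>, so it cannot be universal.\<close>
    have universal_iff: "universal v \<longleftrightarrow> even (f v)" if v: "v \<in> V" for v
    proof
      assume "universal v"
      show "even (f v)"
      proof (rule ccontr)
        assume odd: "odd (f v)"
        then obtain y where y: "y \<in> pverts H" "y \<noteq> f v div 2" "(f v div 2, y) \<notin> parcs H"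
          using nuH[of "f v div 2"] fV[OF v] by (auto simp: vJ)
        let ?w = "g (2 * y + 1)"
        have w: "?w \<in> V" "f ?w = 2 * y + 1" using g[of "2 * y + 1"] y by (auto simp: vJ)
        have "(v, ?w) \<notin> parcs G" using f[OF v w(1)] w(2) y odd by (simp add: in_parcs_join)
        moreover have "?w \<noteq> v" using w(2) y(2) by auto
        ultimately show False using \<open>universal v\<close> w edge_iff[OF v w(1)] by (auto simp: universal_def)
      qed
    next
      assume even: "even (f v)"
      have "d v w = 1" if w: "w \<in> V" "w \<noteq> v" for w
      proof -
        have "f v div 2 \<noteq> f w div 2" if "even (f w)"
          using fne[OF v w(1)] w(2) that even by (metis dvd_div_mult_self)
        hence "(f v, f w) \<in> parcs ?J"
          using even fV[OF v] fV[OF w(1)] by (auto simp: in_parcs_join vJ in_parcs_simps(1) pverts_simps(1) split: if_splits)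
        thus ?thesis using f[OF v w(1)] edge_iff[OF v w(1)] by simp
      qed
      thus "universal v" using v by (simp add: universal_def)
    qed
    let ?ws = "map (\<lambda>h. g (2 * h + 1)) hs"
    have gh: "g (2 * h + 1) \<in> V" "f (g (2 * h + 1)) = 2 * h + 1" if "h \<in> set hs" for h
      using g[of "2 * h + 1"] that hs(2) by (auto simp: vJ)
    have "inj_on (\<lambda>h. g (2 * h + 1)) (set hs)"
    proof (rule inj_onI)
      fix h h' assume "h \<in> set hs" "h' \<in> set hs" "g (2 * h + 1) = g (2 * h' + 1)"
      thus "h = h'" using gh(2)[of h] gh(2)[of h'] by simp
    qed
    hence "distinct ?ws" using hs(1) by (simp add: distinct_map)
    moreover have "set ?ws = others"
    proof (intro subset_antisym subsetI)
      fix v assume "v \<in> set ?ws"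
      then obtain h where h: "h \<in> set hs" "v = g (2 * h + 1)" by auto
      thus "v \<in> others" using gh[OF h(1)] universal_iff by (simp add: others_def)
    next
      fix v assume v: "v \<in> others"
      hence vV: "v \<in> V" and odd: "odd (f v)" using universal_iff by (auto simp: others_def)
      hence "f v div 2 \<in> set hs" using fV[OF vV] hs(2) by (simp add: vJ)
      moreover have "v = g (2 * (f v div 2) + 1)" using gf[OF vV] odd by simp
      ultimately show "v \<in> set ?ws" by auto
    qed
    moreover have "adj_rows adjacent ?ws = R"
      unfolding adj_rows_map hs(3)[symmetric]
    proof (rule adj_rows_cong[OF hs(1)])
      fix x y assume "x \<in> set hs" "y \<in> set hs" "x \<noteq> y"
      thus "(d (g (2 * x + 1)) (g (2 * y + 1)) = 1) = ((x, y) \<in> parcs H)"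
        using gh[of x] gh[of y] f edge_iff by (auto simp: in_parcs_join)
    qed
    ultimately show "realizes adjacent others R" unfolding realizes_def by blast
  next
    assume "realizes adjacent others R"
    then obtain ws where ws: "distinct ws" "set ws = others" "adj_rows adjacent ws = R"
      by (auto simp: realizes_def)
    have lenw: "length ws = length R" using ws(3) by auto
    have oV: "others \<subseteq> V" by (auto simp: others_def)
    have "card others = length R" using ws lenw distinct_card by metis
    hence "card (V - others) = k"
      using card oV finite by (simp add: card_Diff_subset finite_subset)
    then obtain h where h: "bij_betw h (V - others) {..<k}"
      using finite ex_bij_betw_finite_nat[of "V - others"] by (auto simp: atLeast0LessThan)
    \<comment> \<open>Matches \<open>ws\<close> with \<open>hs\<close> position by position; the
      equal codes make this an isomorphism.\<close>
    define \<phi> where "\<phi> = (\<lambda>v. hs ! the_inv_into {..<length R} ((!) ws) v)"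
    have bw: "bij_betw ((!) ws) {..<length R} others"
      using bij_betw_nth[OF ws(1)] ws(2) lenw by auto
    have \<phi>_nth: "\<phi> (ws ! i) = hs ! i" if "i < length R" for i
      using bw that by (simp add: \<phi>_def bij_betw_def the_inv_into_f_f)
    have "bij_betw ((!) hs) {..<length R} (pverts H)"
      using bij_betw_nth[OF hs(1)] hs(2) len by auto
    from bij_betw_trans[OF bij_betw_the_inv_into[OF bw] this]
    have \<phi>: "bij_betw \<phi> others (pverts H)" by (simp add: \<phi>_def comp_def)
    define f where "f = (\<lambda>v. if v \<in> others then 2 * \<phi> v + 1 else 2 * h v)"
    have "bij_betw f (others \<union> (V - others)) ((\<lambda>i. 2 * i + 1) ` pverts H \<union> (\<lambda>i. 2 * i) ` {..<k})"
    proof (rule bij_betw_combine)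
      have "bij_betw (\<lambda>i. 2 * i + 1) (pverts H) ((\<lambda>i. 2 * i + 1) ` pverts H)"
        by (rule inj_on_imp_bij_betw) (auto simp: inj_on_def)
      from bij_betw_trans[OF \<phi> this]
      show "bij_betw f others ((\<lambda>i. 2 * i + 1) ` pverts H)"
        by (rule iffD1[OF bij_betw_cong, rotated]) (simp add: f_def)
      have "bij_betw (\<lambda>i. 2 * i) {..<k} ((\<lambda>i. 2 * i) ` {..<k})"
        by (rule inj_on_imp_bij_betw) (auto simp: inj_on_def)
      from bij_betw_trans[OF h this]
      show "bij_betw f (V - others) ((\<lambda>i. 2 * i) ` {..<k})"
        by (rule iffD1[OF bij_betw_cong, rotated]) (simp add: f_def)
      show "(\<lambda>i. 2 * i + 1) ` pverts H \<inter> (\<lambda>i. 2 * i) ` {..<k} = {}"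
        by (auto, presburger)
    qed
    moreover have "others \<union> (V - others) = V" using oV by blast
    moreover have "(\<lambda>i. 2 * i + 1) ` pverts H \<union> (\<lambda>i. 2 * i) ` {..<k} = pverts ?J"
      by (auto simp: join_def Let_def disj_union_def complete_graph_def)
    ultimately have bij: "bij_betw f V (pverts ?J)" by simp
    have fV: "f v \<in> pverts ?J" if "v \<in> V" for v using bij that by (auto simp: bij_betw_def)
    have fne: "f u \<noteq> f v" if "u \<in> V" "v \<in> V" "u \<noteq> v" for u v
      using bij that by (auto simp: bij_betw_def dest: inj_onD)
    have even: "even (f v) \<longleftrightarrow> v \<notin> others" for v by (simp add: f_def)
    have arc_others: "(u, v) \<in> parcs G \<longleftrightarrow> (\<phi> u, \<phi> v) \<in> parcs H" if "u \<in> others" "v \<in> others" for u v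
    proof -
      have "\<exists>i<length R. u = ws ! i" "\<exists>j<length R. v = ws ! j"
        using that in_set_conv_nth[of u ws] in_set_conv_nth[of v ws] unfolding ws(2) lenw by blast+
      then obtain i j where ij: "i < length R" "j < length R" "u = ws ! i" "v = ws ! j" by blast
      have uv: "u \<in> V" "v \<in> V" using that oV by auto
      have less: "d (ws ! i) (ws ! j) = 1 \<longleftrightarrow> (hs ! i, hs ! j) \<in> parcs H" if "i < j" "j < length R" for i j
        using adj_rows_nth[of i j ws adjacent] adj_rows_nth[of i j hs "\<lambda>x y. (x, y) \<in> parcs H"]
          that lenw len ws(3) hs(3) by simp
      consider "i < j" | "i = j" | "j < i" by linarith
      thus ?thesis
      proof cases
        case 1
        thus ?thesis using less[of i j] ij edge_iff[OF uv] by (simp add: \<phi>_nth)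
      next
        case 2
        thus ?thesis using ij uv simple simpleH by (auto simp: simple_graph_def irrefl_def)
      next
        case 3
        have "(u, v) \<in> parcs G \<longleftrightarrow> d v u = 1" using edge_iff[OF uv] sym[OF uv] by simp
        also have "\<dots> \<longleftrightarrow> (hs ! j, hs ! i) \<in> parcs H" using less[of j i] 3 ij by simp
        also have "\<dots> \<longleftrightarrow> (hs ! i, hs ! j) \<in> parcs H" using simpleH by (auto simp: simple_graph_def dest: symD)
        finally show ?thesis using ij by (simp add: \<phi>_nth)
      qed
    qed
    have "(u, v) \<in> parcs G \<longleftrightarrow> (f u, f v) \<in> parcs ?J" if uv: "u \<in> V" "v \<in> V" for u v
    proof (cases "u \<in> others \<and> v \<in> others")
      case True
      thus ?thesis using arc_others by (simp add: in_parcs_join f_def)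
    next
      case False
      hence "universal u \<or> universal v" using uv by (auto simp: others_def)
      hence "(u, v) \<in> parcs G \<longleftrightarrow> u \<noteq> v"
        using edge_iff[OF uv] sym[OF uv] uv by (auto simp: universal_def)
      also have "\<dots> \<longleftrightarrow> (f u, f v) \<in> parcs ?J"
      proof (cases "u = v")
        case True
        thus ?thesis using False by (auto simp: in_parcs_join in_parcs_simps(1) even)
      next
        case ne: False
        have "f u div 2 \<noteq> f v div 2" if "u \<notin> others" "v \<notin> others"
          using fne[OF uv ne] that by (simp add: f_def)
        thus ?thesis using ne False fV[OF uv(1)] fV[OF uv(2)]
          by (auto simp: in_parcs_join vJ even in_parcs_simps(1) pverts_simps(1) split: if_splits)
      qed
      finally show ?thesis .
    qed
    thus "isomorphic G ?J" using iso bij by blast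
  qed
qed

text \<open>A metric description of P4, matching the conclusion of
  \<open>diam_3_path\<close>.\<close>

definition is_path4 :: bool where
  "is_path4 \<longleftrightarrow> (\<exists>p. V = p ` {..3} \<and> inj_on p {..3} \<and>
     (\<forall>i j. i \<le> j \<longrightarrow> j \<le> 3 \<longrightarrow> d (p i) (p j) = j - i))"

lemma isomorphic_path_graph_4_iff: "isomorphic G (path_graph 4) \<longleftrightarrow> is_path4"
proof -
  have iso: "isomorphic G (path_graph 4) \<longleftrightarrow> (\<exists>f. bij_betw f V {..<4} \<and>
      (\<forall>u\<in>V. \<forall>v\<in>V. (u, v) \<in> parcs G \<longleftrightarrow> (f u, f v) \<in> parcs (path_graph 4)))"
    unfolding isomorphic_iff_bij[OF simple simple_path_graph] by (simp add: path_graph_def)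
  have I: "{..<4} = {..3::nat}" by auto
  show ?thesis
  proof
    assume "isomorphic G (path_graph 4)"
    then obtain f where bij: "bij_betw f V {..3}"
      and f: "\<And>u v. u \<in> V \<Longrightarrow> v \<in> V \<Longrightarrow> (u, v) \<in> parcs G \<longleftrightarrow> (f u, f v) \<in> parcs (path_graph 4)"
      using iso I by auto
    define p where "p = inv_into V f"
    have bp: "bij_betw p {..3} V" unfolding p_def by (rule bij_betw_inv_into[OF bij])
    have fp: "f (p i) = i" if "i \<le> 3" for i
      using bij that by (auto simp: p_def bij_betw_def f_inv_into_f)
    have pV: "p i \<in> V" if "i \<le> 3" for i using bp that by (auto simp: bij_betw_def)
    have pne: "p i \<noteq> p j" if "i \<le> 3" "j \<le> 3" "i \<noteq> j" for i j
      using fp that by metis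
    have one: "d (p i) (p j) = 1 \<longleftrightarrow> j = i + 1 \<or> i = j + 1" if "i \<le> 3" "j \<le> 3" for i j
      using edge_iff[of "p i" "p j"] f[of "p i" "p j"] pV fp that by (auto simp: path_graph_def)
    have two: "d (p i) (p j) = 2" if "j = i + 2" "j \<le> 3" for i j
    proof -
      have "d (p i) (p j) \<le> d (p i) (p (i + 1)) + d (p (i + 1)) (p j)"
        using triangle pV that by auto
      moreover have "d (p i) (p (i + 1)) = 1" "d (p (i + 1)) (p j) = 1" "d (p i) (p j) \<noteq> 1"
        using one that by auto
      moreover have "d (p i) (p j) \<noteq> 0" using d_eq_0 pV pne that by auto
      ultimately show ?thesis by linarith
    qed
    have three: "d (p 0) (p 3) = 3"
    proof -
      have "d (p 0) (p 3) \<le> d (p 0) (p 1) + d (p 1) (p 3)" using triangle pV by auto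
      hence "d (p 0) (p 3) \<le> 3" using one[of 0 1] two[of 3 1] by auto
      moreover have "d (p 0) (p 3) \<noteq> 0" using d_eq_0 pV pne by auto
      moreover have "d (p 0) (p 3) \<noteq> 1" using one[of 0 3] by auto
      moreover have "d (p 0) (p 3) \<noteq> 2"
      proof
        \<comment> \<open>Distance 2 would provide a common neighbour of the two ends, but no index
          differs from both 0 and 3 by one.\<close>
        assume two': "d (p 0) (p 3) = 2"
        obtain q where q: "q 0 = p 0" "q 2 = p 3" "\<And>i. i \<le> 2 \<Longrightarrow> q i \<in> V"
          "\<And>i j. i \<le> j \<Longrightarrow> j \<le> 2 \<Longrightarrow> d (q i) (q j) = j - i"
          using geodesic[of "p 0" "p 3"] pV unfolding two' by auto
        have q1: "q 1 \<in> V" "d (p 0) (q 1) = 1" "d (q 1) (p 3) = 1"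
          using q(3)[of 1] q(4)[of 0 1] q(4)[of 1 2] q(1,2) by simp_all
        then obtain i where "i \<le> 3" "q 1 = p i" using bp by (auto simp: bij_betw_def)
        thus False using q1(2,3) one[of 0 i] one[of i 3] by auto
      qed
      ultimately show ?thesis by linarith
    qed
    have "d (p i) (p j) = j - i" if le: "i \<le> j" "j \<le> 3" for i j
    proof -
      consider "j = i" | "j = i + 1" | "j = i + 2" | "i = 0 \<and> j = 3" using le by linarith
      thus ?thesis using pV one[of i j] two[of j i] three le by cases auto
    qed
    thus is_path4 unfolding is_path4_def using bp by (intro exI[of _ p]) (auto simp: bij_betw_def)
  next
    assume is_path4
    then obtain p where V: "V = p ` {..3}" and inj: "inj_on p {..3}"
      and dp: "\<And>i j. i \<le> j \<Longrightarrow> j \<le> 3 \<Longrightarrow> d (p i) (p j) = j - i"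
      by (auto simp: is_path4_def)
    define f where "f = the_inv_into {..3} p"
    have fp: "f (p i) = i" if "i \<le> 3" for i
      using inj that by (simp add: f_def the_inv_into_f_f)
    have "bij_betw f V {..<4}" unfolding f_def I V
      by (rule bij_betw_the_inv_into) (use inj in \<open>simp add: bij_betw_def\<close>)
    moreover have "(u, v) \<in> parcs G \<longleftrightarrow> (f u, f v) \<in> parcs (path_graph 4)" if uv: "u \<in> V" "v \<in> V" for u v
    proof -
      obtain i j where ij: "u = p i" "v = p j" "i \<le> 3" "j \<le> 3" using uv V by auto
      have "d u v = (if i \<le> j then j - i else i - j)"
        using dp[of i j] dp[of j i] ij sym[OF uv] by auto
      thus ?thesis using edge_iff[OF uv] ij fp by (auto simp: path_graph_def)
    qed
    ultimately show "isomorphic G (path_graph 4)" using iso by blast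
  qed
qed

end

section \<open>The classification\<close>

locale graph_eccentricity = distance_graph G d + graph_spectrum "pverts G" d vs
  for G :: "'a pair_pre_digraph" and d vs
begin

lemma nonsing_card_le_rank: "S \<subseteq> V \<Longrightarrow> nonsing S \<Longrightarrow> card S \<le> card V - mult"
  using nonsing_card_le[of S] by linarith

text \<open>P4 has no universal vertex, so the rank is at least 3; an explicit kernel vector shows
  that it is not 4.\<close>

lemma mult_path4:
  assumes is_path4
  shows "mult + 3 = card V"
proof -
  obtain p where V: "V = p ` {..3}" and inj: "inj_on p {..3}"
    and dp: "\<And>i j. i \<le> j \<Longrightarrow> j \<le> 3 \<Longrightarrow> d (p i) (p j) = j - i"
    using assms by (auto simp: is_path4_def)
  have pV: "p i \<in> V" if "i \<le> 3" for i using V that by auto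
  have pd: "d (p i) (p j) = (if i \<le> j then j - i else i - j)" if "i \<le> 3" "j \<le> 3" for i j
    using dp[of i j] dp[of j i] sym[of "p i" "p j"] pV that by auto
  have ecc: "ecc (p j) = max j (3 - j)" if j: "j \<le> 3" for j
  proof (rule antisym)
    obtain u where u: "u \<in> V" "d u (p j) = ecc (p j)" using ecc_attained by blast
    then obtain i where "i \<le> 3" "u = p i" using V by auto
    thus "ecc (p j) \<le> max j (3 - j)" using u(2) pd[of i j] j by (auto split: if_splits)
    show "max j (3 - j) \<le> ecc (p j)"
      using d_le_ecc[of "p 0" "p j"] d_le_ecc[of "p 3" "p j"] pd[of 0 j] pd[of 3 j] pV j
      by (auto split: if_splits)
  qed
  have pne: "p i = p j \<longleftrightarrow> i = j" if "i \<le> 3" "j \<le> 3" for i j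
    using inj that by (auto simp: inj_on_eq_iff)
  have "\<not> universal v" for v
  proof
    assume univ: "universal v"
    hence "v \<in> V" unfolding universal_def by blast
    then obtain i where i: "i \<le> 3" "v = p i" using V by blast
    \<comment> \<open>The index of a path vertex at distance 2 from \<open>p i\<close>.\<close>
    define j where "j = (if i \<le> 1 then i + 2 else i - 2)"
    have "j \<le> 3" "i \<noteq> j" "d (p i) (p j) = 2" using i(1) pd[of i j] by (auto simp: j_def)
    thus False using univ i pne[of j i] pV[of j] by (auto simp: universal_def)
  qed
  hence "3 \<le> card V - mult"
    by (rule card_le_if_no_universal(1)) (use nonsing_card_le_rank in auto)
  hence ge: "mult + 3 \<le> card V" by linarith
  have I: "{..3::nat} = {0, 1, 2, 3}" by auto
  \<comment> \<open>The vector (1, -2, -2, 1) along the path. Its value 1 at \<open>p 3\<close> is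
    the normalisation for \<open>T = V - {p 3}\<close>.\<close>
  define x :: "'a \<Rightarrow> real" where "x = (\<lambda>w. if w = p 0 \<or> w = p 3 then 1 else - 2)"
  have row: "(\<Sum>w\<in>V. shifted v w * x w) = 0" if v: "v \<in> V" for v
  proof -
    obtain j where j: "j \<le> 3" "v = p j" using V v by auto
    have sh: "shifted (p j) (p i) = (if i = j then 1
        else if (if j \<le> i then i - j else j - i) = min (max j (3 - j)) (max i (3 - i))
          then int (if j \<le> i then i - j else j - i) else 0)" if "i \<le> 3" for i
      using that j(1) ecc pd pne pV by (simp add: shifted_def far_def)
    have "(\<Sum>w\<in>V. shifted v w * x w) = (\<Sum>i\<le>3. shifted (p j) (p i) * x (p i))"
      unfolding V j(2) by (simp add: sum.reindex[OF inj])
    also have "\<dots> = (\<Sum>i\<le>3. real_of_int (shifted (p j) (p i)) * (if i = 0 \<or> i = 3 then 1 else - 2))"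
      by (intro sum.cong refl) (auto simp: x_def pne)
    also have "\<dots> = 0"
    proof -
      have "j = 0 \<or> j = 1 \<or> j = 2 \<or> j = 3" using j(1) by linarith
      thus ?thesis using sh[of 0] sh[of 1] sh[of 2] sh[of 3] by (elim disjE) (simp_all add: I)
    qed
    finally show ?thesis .
  qed
  have "card V \<le> mult + card (V - {p 3})"
  proof (rule kernel_card_le[of _ "\<lambda>v. x"])
    show "x v = 1" if "v \<in> V - (V - {p 3})" for v using that by (simp add: x_def)
  qed (use row in auto)
  hence "card V \<le> mult + (card V - 1)" using pV finite by simp
  moreover have "card V = 4" unfolding V using card_image[OF inj] by simp
  ultimately show ?thesis using ge by linarith
qed

text \<open>With a universal vertex, 0, 2, 3 or 4 other vertices give rank one more than their
  number, five give 5 exactly in the singular case, and more give at least 6. Without one, the order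
  bounds leave only P4.\<close>

lemma multiplicity_classification:
  assumes n: "card V = n"
  shows "mult + 1 = n \<longleftrightarrow> others = {}"
    and "mult + 2 \<noteq> n"
    and "n \<ge> 4 \<Longrightarrow> mult + 3 = n \<longleftrightarrow> card others = 2 \<or> is_path4"
    and "n \<ge> 9 \<Longrightarrow> mult + 4 = n \<longleftrightarrow> card others = 3"
    and "n \<ge> 16 \<Longrightarrow> mult + 5 = n \<longleftrightarrow>
      card others = 4 \<or> card others = 5 \<and> \<not> nonsing_on (seidel adjacent) others"
proof -
  have adj_sym: "adjacent x y = adjacent y x" if "x \<in> others" "y \<in> others" for x y
    using sym[of x y] that by (simp add: others_def)
  have fin: "finite others" using finite by (simp add: others_def)
  have path4: "card V = 4" if is_path4
    using that card_image[of _ "{..3::nat}"] by (auto simp: is_path4_def)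
  have "(mult + 1 = n \<longleftrightarrow> others = {}) \<and> mult + 2 \<noteq> n
    \<and> (n \<ge> 4 \<longrightarrow> (mult + 3 = n \<longleftrightarrow> card others = 2 \<or> is_path4))
    \<and> (n \<ge> 9 \<longrightarrow> (mult + 4 = n \<longleftrightarrow> card others = 3))
    \<and> (n \<ge> 16 \<longrightarrow> (mult + 5 = n \<longleftrightarrow>
      card others = 4 \<or> card others = 5 \<and> \<not> nonsing_on (seidel adjacent) others))"
  proof (cases "\<exists>u. universal u")
    case True
    then obtain u where u: "universal u" by blast
    note m = mult_universal[OF u, unfolded n]
    have empty: "others = {} \<longleftrightarrow> card others = 0" using fin by simp
    have nonsing_small: "nonsing_on (seidel adjacent) others" if "card others \<in> {0, 2, 3, 4}"
    proof (cases "card others = 0")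
      case True
      thus ?thesis using fin by (simp add: nonsing_on_def)
    next
      case False
      thus ?thesis using that adj_sym by (intro nonsing_on_seidel_small) auto
    qed
    have small: "mult + card others + 1 = n" if "card others \<in> {0, 2, 3, 4}"
      by (rule m(3)[OF nonsing_small[OF that]])
    \<comment> \<open>Here \<open>n = 4\<close> and \<open>mult = 1\<close>, so
      \<open>card others\<close> is 2 or 3 by the rank bounds, and 3 would make the rank 4. This
      absorbs the alternative \<open>is_path4\<close> into the first one.\<close>
    have not_path: "mult + 3 = n \<Longrightarrow> is_path4 \<Longrightarrow> card others = 2"
      using path4 small card_others_neq_1 m(1,2) n by force
    have "is_path4 \<Longrightarrow> mult + 3 = n" using mult_path4 n by simp
    hence path: "is_path4 \<Longrightarrow> card others = 2" using not_path by blast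
    have five: "mult + 5 = n \<longleftrightarrow> \<not> nonsing_on (seidel adjacent) others" if "card others = 5"
      using m(3,4) that by auto
    consider "card others = 0" | "card others = 2" | "card others = 3" | "card others = 4"
      | "card others = 5" | "card others \<ge> 6"
      using card_others_neq_1 by linarith
    thus ?thesis
    proof cases
      case 5
      hence "\<not> is_path4" using path by auto
      thus ?thesis using 5 five m(1) by (auto simp: empty)
    next
      case 6
      hence "\<not> is_path4" using path by auto
      thus ?thesis using 6 m(1) by (auto simp: empty)
    qed (use small path in \<open>auto simp: empty\<close>)
  next
    case False
    hence nu: "\<not> universal v" for v by blast
    have o: "others = V" using nu by (auto simp: others_def)
    note r = card_le_if_no_universal[OF nu nonsing_card_le_rank]
    have "3 \<le> n - mult" using r(1) n by simp
    hence le: "mult + 3 \<le> n" by linarith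
    have "is_path4" if "mult + 3 = n" "4 \<le> n"
      unfolding is_path4_def using r(2) that n by simp
    moreover have "mult + 3 = n" if is_path4 using mult_path4[OF that] n by simp
    moreover have "\<not> (mult + 4 = n \<and> 9 \<le> n)" using r(3) n by linarith
    moreover have "\<not> (mult + 5 = n \<and> 16 \<le> n)" using r(4) n by linarith
    moreover have "others \<noteq> {}" using o nonempty by simp
    ultimately show ?thesis using le n o by auto
  qed
  thus "mult + 1 = n \<longleftrightarrow> others = {}" "mult + 2 \<noteq> n"
    "n \<ge> 4 \<Longrightarrow> mult + 3 = n \<longleftrightarrow> card others = 2 \<or> is_path4"
    "n \<ge> 9 \<Longrightarrow> mult + 4 = n \<longleftrightarrow> card others = 3"
    "n \<ge> 16 \<Longrightarrow> mult + 5 = n \<longleftrightarrow>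
      card others = 4 \<or> card others = 5 \<and> \<not> nonsing_on (seidel adjacent) others"
    by blast+
qed

lemma card_if_realizes: "realizes E W R \<Longrightarrow> card W = length R"
  unfolding realizes_def using distinct_card by fastforce

lemma card_others_eq_2_iff: "card others = 2 \<longleftrightarrow> realizes adjacent others [[False], []]"
proof
  assume "card others = 2"
  then obtain a b where ab: "others = {a, b}" "a \<noteq> b" by (auto simp: card_2_iff)
  hence "\<not> adjacent a b" using others_nonadjacent[of a] by auto
  thus "realizes adjacent others [[False], []]"
    unfolding realizes_def using ab by (intro exI[of _ "[a, b]"]) auto
qed (drule card_if_realizes, simp)

lemma adjacent_others_sym: "x \<in> others \<Longrightarrow> y \<in> others \<Longrightarrow> adjacent x y = adjacent y x"
  using sym[of x y] by (simp add: others_def)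

lemma card_others_eq_3_iff: "card others = 3 \<longleftrightarrow>
  realizes adjacent others [[True, False], [False], []] \<or> realizes adjacent others [[False, False], [False], []]"
  using realizes_3[OF adjacent_others_sym _ others_nonadjacent] card_if_realizes[of adjacent others]
  by fastforce

lemma card_others_eq_4_iff: "card others = 4 \<longleftrightarrow> (\<exists>R\<in>set rows4. realizes adjacent others R)"
proof
  show "card others = 4 \<Longrightarrow> \<exists>R\<in>set rows4. realizes adjacent others R"
    by (rule realizes_4[OF adjacent_others_sym _ others_nonadjacent])
  show "card others = 4" if "\<exists>R\<in>set rows4. realizes adjacent others R"
    using that card_if_realizes[of adjacent others] by (auto simp: rows4_def)
qed

lemma card_others_eq_5_iff: "card others = 5 \<and> \<not> nonsing_on (seidel adjacent) others \<longleftrightarrow>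
  (\<exists>R\<in>set rows5. realizes adjacent others R)"
proof
  show "card others = 5 \<and> \<not> nonsing_on (seidel adjacent) others \<Longrightarrow>
      \<exists>R\<in>set rows5. realizes adjacent others R"
    using realizes_5[OF adjacent_others_sym _ others_nonadjacent] by blast
  assume "\<exists>R\<in>set rows5. realizes adjacent others R"
  then obtain R where R: "R \<in> set rows5" "realizes adjacent others R" by blast
  have "length R = 5" using R(1) by (auto simp: rows5_def)
  thus "card others = 5 \<and> \<not> nonsing_on (seidel adjacent) others"
    using card_if_realizes[OF R(2)] singular_if_realizes_5[OF adjacent_others_sym R] by simp
qed

end

section \<open>Walks in the graph and the abstract distance\<close>

text \<open>Replaces walks by powers of the arc relation, whose composition and reversal give the
  triangle inequality and symmetry.\<close>

lemma awalk_length_iff: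
  "(\<exists>p. pre_digraph.awalk (with_proj G) u p v \<and> length p = k)
    \<longleftrightarrow> u \<in> pverts G \<and> (u, v) \<in> parcs G ^^ k"
proof -
  have "(\<exists>p. set p \<subseteq> parcs G \<and> pcas u p v \<and> length p = k) \<longleftrightarrow> (u, v) \<in> parcs G ^^ k"
  proof (induction k arbitrary: u)
    case (Suc k)
    have "(\<exists>p. set p \<subseteq> parcs G \<and> pcas u p v \<and> length p = Suc k) \<longleftrightarrow>
        (\<exists>w. (u, w) \<in> parcs G \<and> (\<exists>p. set p \<subseteq> parcs G \<and> pcas w p v \<and> length p = k))"
      (is "?L \<longleftrightarrow> ?R")
    proof
      assume ?L
      then obtain e p where "set (e # p) \<subseteq> parcs G" "pcas u (e # p) v" "length p = k"
        by (auto simp: length_Suc_conv)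
      thus ?R by (cases e) auto
    next
      assume ?R
      then obtain w p where "(u, w) \<in> parcs G" "set p \<subseteq> parcs G" "pcas w p v" "length p = k" by blast
      thus ?L by (intro exI[of _ "(u, w) # p"]) auto
    qed
    also have "\<dots> \<longleftrightarrow> (u, v) \<in> parcs G O parcs G ^^ k" unfolding Suc by blast
    finally show ?case by (simp add: relpow_commute)
  qed auto
  thus ?thesis by (auto simp: pre_digraph.awalk_def cas_with_proj_eq)
qed

lemma relpow_sym: "sym R \<Longrightarrow> (u, v) \<in> R ^^ k \<Longrightarrow> (v, u) \<in> R ^^ k"
proof (induction k arbitrary: v)
  case (Suc k)
  then obtain w where "(u, w) \<in> R ^^ k" "(w, v) \<in> R" by auto
  hence "(v, u) \<in> R O R ^^ k" using Suc by (auto dest: symD)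
  thus ?case by (simp add: relpow_commute)
qed auto

text \<open>Connectedness makes the set of walk lengths nonempty, so the least length is attained.
  Its properties are then those of relation powers.\<close>

lemma gdist_graph_distance:
  assumes "pair_graph G" and "connected (with_proj G)"
  shows "distance_graph G (gdist G)"
proof -
  interpret pair_graph G by fact
  let ?V = "pverts G" and ?R = "parcs G"
  have symR: "sym ?R" using pair_sym_arcs by (simp add: symmetric_def)
  have RV: "?R \<subseteq> ?V \<times> ?V" by (auto dest: wellformed')
  have irr: "irrefl ?R" using pair_no_loops by (force simp: irrefl_def)
  have sc: "strongly_connected (mk_symmetric (with_proj G))" using assms(2) by (simp add: connected_def)
  hence ne: "?V \<noteq> {}" by (auto simp: strongly_connected_def)
  \<comment> \<open>Connectedness refers to the symmetric closure, which adds no arcs to a symmetric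
    graph.\<close>
  have parcs_sym: "parcs (mk_symmetric (with_proj G)) = ?R"
    using symR by (auto simp: parcs_mk_symmetric dest: symD)
  define D where "D = (\<lambda>u v. LEAST k. (u, v) \<in> ?R ^^ k)"
  have gd: "gdist G u v = D u v" if "u \<in> ?V" for u v
    unfolding gdist_def awalk_length_iff D_def using that by simp
  have reach: "(u, v) \<in> ?R ^^ D u v" if "u \<in> ?V" "v \<in> ?V" for u v
  proof -
    have "u \<rightarrow>\<^sup>*\<^bsub>mk_symmetric (with_proj G)\<^esub> v" using sc that by (simp add: strongly_connected_def)
    hence "(u, v) \<in> ?R\<^sup>*" using reachable_rtranclI parcs_sym
      by (metis with_proj_simps(3))
    then obtain k where "(u, v) \<in> ?R ^^ k" using rtrancl_imp_relpow by blast
    thus ?thesis unfolding D_def by (rule LeastI)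
  qed
  have least: "D u v \<le> k" if "(u, v) \<in> ?R ^^ k" for u v k
    unfolding D_def using that by (rule Least_le)
  have D1: "D u v = 1 \<longleftrightarrow> (u, v) \<in> ?R" if "u \<in> ?V" "v \<in> ?V" for u v
  proof
    assume "D u v = 1"
    thus "(u, v) \<in> ?R" using reach[OF that] by simp
  next
    assume uv: "(u, v) \<in> ?R"
    have "D u v \<le> 1" using least[of u v 1] uv by simp
    moreover have "D u v \<noteq> 0" using reach[OF that] uv irr
      by (intro notI) (simp add: irrefl_def)
    ultimately show "D u v = 1" by simp
  qed
  show ?thesis
  proof
    show "finite ?V" by (rule pair_finite_verts)
    show "?V \<noteq> {}" by (rule ne)
    show "simple_graph G" using symR RV irr by (simp add: simple_graph_def)
  next
    fix u v assume uv: "u \<in> ?V" "v \<in> ?V"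
    show "gdist G u v = 0 \<longleftrightarrow> u = v" using reach[OF uv] least[of u v 0] uv by (auto simp: gd)
    show "gdist G u v = gdist G v u"
      using least[OF relpow_sym[OF symR reach[OF uv]]] least[OF relpow_sym[OF symR reach[OF uv(2,1)]]] uv
      by (simp add: gd)
    show "(u, v) \<in> ?R \<longleftrightarrow> gdist G u v = 1" using D1[OF uv] uv by (simp add: gd)
    obtain p where p: "p 0 = u" "p (D u v) = v" "\<And>i. i < D u v \<Longrightarrow> (p i, p (Suc i)) \<in> ?R"
      using reach[OF uv] unfolding relpow_fun_conv by blast
    have pV: "p i \<in> ?V" if "i \<le> D u v" for i
      using p(1) p(3)[of "i - 1"] RV uv that by (cases i) auto
    show "\<exists>p. p 0 = u \<and> p (gdist G u v) = v \<and> (\<forall>i\<le>gdist G u v. p i \<in> ?V) \<and>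
        (\<forall>i<gdist G u v. gdist G (p i) (p (Suc i)) = 1)"
      unfolding gd[OF uv(1)] using p pV D1 by (intro exI[of _ p]) (auto simp: gd)
  next
    fix u v w assume uvw: "u \<in> ?V" "v \<in> ?V" "w \<in> ?V"
    have "(u, w) \<in> ?R ^^ (D u v + D v w)" unfolding relpow_add using reach uvw by blast
    thus "gdist G u w \<le> gdist G u v + gdist G v w" using least uvw by (simp add: gd)
  qed
qed

theorem theorem1p1:
  fixes G :: "'a pair_pre_digraph" and vs :: "'a list" and n m :: nat
  assumes "pair_graph G" and "connected (with_proj G)" and "card (pverts G) = n"
    and "distinct vs" and "set vs = pverts G"
    and "m = eigenvalue_multiplicity (ecc_mat G vs) (- 1)"
  shows "(int m = int n - 1 \<longleftrightarrow> isomorphic G (complete_graph n))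
    \<and> int m \<noteq> int n - 2
    \<and> (n \<ge> 4 \<longrightarrow>
        (int m = int n - 3 \<longleftrightarrow>
          (\<exists>H \<in> {complete_graph (n - 2) \<or>\<^sub>g copies 2 (complete_graph 1), path_graph 4}.
             isomorphic G H)))
    \<and> (n \<ge> 9 \<longrightarrow>
        (int m = int n - 4 \<longleftrightarrow>
          (\<exists>H \<in> {complete_graph (n - 3) \<or>\<^sub>g (complete_graph 2 \<oplus>\<^sub>g complete_graph 1),
                complete_graph (n - 3) \<or>\<^sub>g copies 3 (complete_graph 1)}.
             isomorphic G H)))
    \<and> (n \<ge> 16 \<longrightarrow>
        (int m = int n - 5 \<longleftrightarrow>
          (\<exists>H \<in> G1_family n \<union>
               {complete_graph (n - 5) \<or>\<^sub>g cycle_graph 5,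
                complete_graph (n - 5) \<or>\<^sub>g (complete_graph 1 \<oplus>\<^sub>g path_graph 4),
                complete_graph (n - 5) \<or>\<^sub>g bull_graph}.
             isomorphic G H)))"
proof -
  interpret distance_graph G "gdist G" by (rule gdist_graph_distance) fact+
  interpret graph_eccentricity G "gdist G" vs by unfold_locales fact+
  have ecc: "ecc v = eccentricity G v" for v by (simp add: ecc_def eccentricity_def)
  have "ecc_mat G vs = fun_mat (\<lambda>u v. real (far u v)) vs"
    by (rule eq_matI) (auto simp: ecc_mat_def fun_mat_def ecc_entry_def far_def ecc)
  hence m: "mult = m" using assms(6) by (simp add: mult_def)
  note n = assms(3)
  note cls = multiplicity_classification[OF n, unfolded m]
  have "int m = int n - 1 \<longleftrightarrow> isomorphic G (complete_graph n)"
    using cls(1) isomorphic_complete_graph_iff n by auto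
  moreover have "int m \<noteq> int n - 2" using cls(2) by auto
  moreover have "int m = int n - 3 \<longleftrightarrow>
      (\<exists>H \<in> {complete_graph (n - 2) \<or>\<^sub>g copies 2 (complete_graph 1), path_graph 4}. isomorphic G H)"
    if "n \<ge> 4"
  proof -
    have "int m = int n - 3 \<longleftrightarrow> m + 3 = n" by auto
    also have "\<dots> \<longleftrightarrow> realizes adjacent others [[False], []] \<or> is_path4"
      using cls(3)[OF that] card_others_eq_2_iff by simp
    finally show ?thesis
      using isomorphic_join_iff[OF coded_by_order_2_3(1), of "n - 2"] isomorphic_path_graph_4_iff n that
      by simp
  qed
  moreover have "int m = int n - 4 \<longleftrightarrow>
      (\<exists>H \<in> {complete_graph (n - 3) \<or>\<^sub>g (complete_graph 2 \<oplus>\<^sub>g complete_graph 1),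
             complete_graph (n - 3) \<or>\<^sub>g copies 3 (complete_graph 1)}. isomorphic G H)"
    if "n \<ge> 9"
  proof -
    have "int m = int n - 4 \<longleftrightarrow> m + 4 = n" by auto
    also have "\<dots> \<longleftrightarrow> realizes adjacent others [[True, False], [False], []]
        \<or> realizes adjacent others [[False, False], [False], []]"
      using cls(4)[OF that] card_others_eq_3_iff by simp
    finally show ?thesis
      using isomorphic_join_iff[OF coded_by_order_2_3(2), of "n - 3"]
        isomorphic_join_iff[OF coded_by_order_2_3(3), of "n - 3"] n that
      by simp
  qed
  moreover have "int m = int n - 5 \<longleftrightarrow>
      (\<exists>H \<in> G1_family n \<union>
           {complete_graph (n - 5) \<or>\<^sub>g cycle_graph 5,
            complete_graph (n - 5) \<or>\<^sub>g (complete_graph 1 \<oplus>\<^sub>g path_graph 4),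
            complete_graph (n - 5) \<or>\<^sub>g bull_graph}. isomorphic G H)"
    if "n \<ge> 16"
  proof -
    have len4: "length (rows4 ! i) = 4" if "i < 7" for i
      using nth_mem[of i rows4] that by (auto simp: rows4_def)
    have len5: "length (rows5 ! i) = 5" if "i < 3" for i
      using nth_mem[of i rows5] that by (auto simp: rows5_def)
    \<comment> \<open>Since \<open>n \<ge> 16\<close>, the difference \<open>n - 4\<close> is not
      truncated, and the orders of both sides agree.\<close>
    have join4: "isomorphic G (complete_graph (n - 4) \<or>\<^sub>g H) \<longleftrightarrow> realizes adjacent others (rows4 ! i)"
      if "coded_by H (rows4 ! i)" "i < 7" for H i
      using isomorphic_join_iff[OF that(1), of "n - 4"] len4[OF that(2)] n \<open>n \<ge> 16\<close> by simp
    have join5: "isomorphic G (complete_graph (n - 5) \<or>\<^sub>g H) \<longleftrightarrow> realizes adjacent others (rows5 ! i)"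
      if "coded_by H (rows5 ! i)" "i < 3" for H i
      using isomorphic_join_iff[OF that(1), of "n - 5"] len5[OF that(2)] n \<open>n \<ge> 16\<close> by simp
    \<comment> \<open>Listing the codes by position pairs them with the members of
      \<open>G1_family\<close>, which come in the same order.\<close>
    have set4: "set rows4 = {rows4 ! 0, rows4 ! 1, rows4 ! 2, rows4 ! 3, rows4 ! 4, rows4 ! 5, rows4 ! 6}"
      by (simp add: rows4_def)
    have set5: "set rows5 = {rows5 ! 0, rows5 ! 1, rows5 ! 2}"
      by (simp add: rows5_def)
    have "int m = int n - 5 \<longleftrightarrow> m + 5 = n" by auto
    also have "\<dots> \<longleftrightarrow> (\<exists>R\<in>set rows4. realizes adjacent others R) \<or> (\<exists>R\<in>set rows5. realizes adjacent others R)"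
      using cls(5)[OF that] card_others_eq_4_iff card_others_eq_5_iff by simp
    also have "\<dots> \<longleftrightarrow> (\<exists>H \<in> G1_family n. isomorphic G H) \<or>
      (\<exists>H \<in> {complete_graph (n - 5) \<or>\<^sub>g cycle_graph 5,
            complete_graph (n - 5) \<or>\<^sub>g (complete_graph 1 \<oplus>\<^sub>g path_graph 4),
            complete_graph (n - 5) \<or>\<^sub>g bull_graph}. isomorphic G H)"
      unfolding set4 set5 G1_family_def Let_def bex_simps
      by (simp only: coded_by_order_4[THEN join4] coded_by_order_5[THEN join5] simp_thms
          insert_iff empty_iff bex_simps)
    finally show ?thesis by blast
  qed
  ultimately show ?thesis by blast
qed

end
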